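(* Let $\alpha>0$, fix $0<c<1$, and let $U_c=\{z\in\mathbb C: c<|z|<1\}$. Then $$\lim_{r\to\infty}\frac1{r^{2\alpha}}\log\mathbf P\big[\mathcal X_\infty^{(\alpha)}(rU_c)=0\big]=-\frac\alpha2\cdot\left(\frac14-\frac{c^{2\alpha}}4+\frac{(1-c^\alpha)^2}{2\alpha\log c}\right).$$
   Context: $rU_c=\{rz:z\in U_c\}$. For $\alpha>0$, $\mathcal X_\infty^{(\alpha)}$ is the determinantal point process in $\mathbb C$ with kernel $\mathbb K_\infty^{(\alpha)}(z,w)=\frac{\alpha}{2\pi}E_{\frac2\alpha,\frac2\alpha}(z\bar w)e^{-\frac{|z|^\alpha}{2}-\frac{|w|^\alpha}{2}}$ with respect to Lebesgue measure $m$ on $\mathbb C$, where $E_{a,b}(z)=\sum_{k=0}^\infty \frac{z^k}{\Gamma(ak+b)}$ is the Mittag-Leffler function. That is, it is a simple point process whose joint intensities (correlation functions) with respect to $m$ are $\rho_k(x_1,\dots,x_k)=\det(\mathbb K_\infty^{(\alpha)}(x_i,x_j))_{1\le i,j\le k}$ for every $k\ge 1$. $\mathcal X_\infty^{(\alpha)}(\Omega)$ denotes the number of points falling in $\Omega\subset\mathbb C$. *)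

theory Defs
  imports "HOL-Probability.Probability" "Jordan_Normal_Form.Determinant"
begin

text \<open>A simple point process in the plane is a random locally finite set of points;
  the sigma-algebra on configurations is the one generated by the counts of bounded Borel sets.\<close>

definition num_points :: "('w \<Rightarrow> complex set) \<Rightarrow> complex set \<Rightarrow> 'w \<Rightarrow> nat" where
  "num_points X \<Omega> \<omega> = card (X \<omega> \<inter> \<Omega>)"

definition simple_point_process :: "'w measure \<Rightarrow> ('w \<Rightarrow> complex set) \<Rightarrow> bool" where
  "simple_point_process M X \<longleftrightarrow>
     prob_space M \<and>
     (\<forall>\<omega>\<in>space M. \<forall>B. bounded B \<longrightarrow> finite (X \<omega> \<inter> B)) \<and>
     (\<forall>B\<in>sets borel. bounded B \<longrightarrow> num_points X B \<in> measurable M (count_space UNIV))"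

text \<open>Joint intensities with respect to Lebesgue measure. The number of points of \<open>X\<close> in an
  unbounded set may be infinite (where \<^const>\<open>card\<close> is \<open>0\<close>), so the test sets are bounded; this
  loses no generality because \<^const>\<open>lborel\<close> is sigma-finite. A point of the k-fold product is a
  function on \<open>{..<k}\<close>.\<close>

definition joint_intensities ::
    "'w measure \<Rightarrow> ('w \<Rightarrow> complex set) \<Rightarrow> (nat \<Rightarrow> (nat \<Rightarrow> complex) \<Rightarrow> real) \<Rightarrow> bool" where
  "joint_intensities M X \<rho> \<longleftrightarrow>
     (\<forall>k\<ge>1.
        \<rho> k \<in> borel_measurable (Pi\<^sub>M {..<k} (\<lambda>_. lborel)) \<and>
        (\<forall>x. 0 \<le> \<rho> k x) \<and>
        (\<forall>x. \<not> inj_on x {..<k} \<longrightarrow> \<rho> k x = 0) \<and>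
        (\<forall>D. (\<forall>i<k. D i \<in> sets borel \<and> bounded (D i)) \<longrightarrow> disjoint_family_on D {..<k} \<longrightarrow>
           (\<integral>\<^sup>+\<omega>. ennreal (\<Prod>i<k. real (num_points X (D i) \<omega>)) \<partial>M) =
           (\<integral>\<^sup>+x\<in>Pi\<^sub>E {..<k} D. ennreal (\<rho> k x) \<partial>(Pi\<^sub>M {..<k} (\<lambda>_. lborel)))))"

text \<open>The determinants are complex numbers by type; the equation forces them to be real.\<close>

definition determinantal_process ::
    "'w measure \<Rightarrow> ('w \<Rightarrow> complex set) \<Rightarrow> (complex \<Rightarrow> complex \<Rightarrow> complex) \<Rightarrow> bool" where
  "determinantal_process M X K \<longleftrightarrow>
     simple_point_process M X \<and>
     (\<exists>\<rho>. joint_intensities M X \<rho> \<and>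
        (\<forall>k\<ge>1. \<forall>x. complex_of_real (\<rho> k x) =
           Determinant.det (Matrix.mat k k (\<lambda>(i, j). K (x i) (x j)))))"

definition mittag_leffler :: "real \<Rightarrow> real \<Rightarrow> complex \<Rightarrow> complex" where
  "mittag_leffler a b z = (\<Sum>k. z ^ k / complex_of_real (Gamma (a * real k + b)))"

definition mittag_leffler_kernel :: "real \<Rightarrow> complex \<Rightarrow> complex \<Rightarrow> complex" where
  "mittag_leffler_kernel \<alpha> z w =
     complex_of_real (\<alpha> / (2 * pi)) * mittag_leffler (2 / \<alpha>) (2 / \<alpha>) (z * cnj w) *
     complex_of_real (exp (- (cmod z powr \<alpha>) / 2 - (cmod w powr \<alpha>) / 2))"

definition annulus :: "real \<Rightarrow> complex set" where
  "annulus c = {z. c < cmod z \<and> cmod z < 1}"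

end

theory Submission
  imports Defs "HOL-Real_Asymp.Real_Asymp"
begin

text \<open>
  Write \<open>q = c\<^sup>\<alpha>\<close>, \<open>R = r\<^sup>\<alpha>\<close> and \<open>s\<^sub>j = 2 (j + 1) / \<alpha>\<close>. The kernel expands as a sum over \<open>j\<close> of products
  \<open>P\<^sub>j(z) Q\<^sub>j(w)\<close>, where \<open>P\<^sub>j\<close> is a radial function times \<open>z\<^sup>j\<close> and \<open>Q\<^sub>j\<close> is a radial function times the
  conjugate of \<open>w\<^sup>j\<close>. Rotation invariance of Lebesgue measure makes these monomials orthogonal on
  every annulus, and on the annulus \<open>r U\<^sub>c\<close> the integral of \<open>P\<^sub>j Q\<^sub>j\<close> is the probability \<open>\<lambda>\<^sub>j\<close> that a
  \<open>Gamma(s\<^sub>j)\<close> variable lies in the interval \<open>(q R, R)\<close>.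

  For a determinantal process the integral of the \<open>k\<close>-point intensity over \<open>A\<^sup>k\<close>, divided by \<open>k!\<close>, is
  then the elementary symmetric function \<open>e\<^sub>k(\<lambda>)\<close>, and inclusion-exclusion gives the hole probability
  \<open>\<Sum>\<^sub>k (-1)\<^sup>k e\<^sub>k(\<lambda>) = \<Prod>\<^sub>j (1 - \<lambda>\<^sub>j)\<close> (\<open>void_probability\<close>, \<open>determinantal_void_probability\<close>,
  \<open>ml_void_probability\<close>). The intensities are only tested on disjoint sets, so the inclusion-exclusion
  identity is obtained from finer and finer dyadic partitions of \<open>A\<close>.

  It remains to evaluate \<open>\<Sum>\<^sub>j ln (1 - \<lambda>\<^sub>j)\<close>. Now \<open>1 - \<lambda>\<^sub>j\<close> is the sum of the two gamma tails below \<open>q R\<close> and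
  above \<open>R\<close>. For \<open>q R \<le> s\<^sub>j \<le> R\<close> both are large deviations, of size \<open>exp (- R (T - u + u ln (u / T)))\<close> with
  \<open>u = s\<^sub>j / R\<close> and \<open>T = q\<close> or \<open>T = 1\<close>, up to polynomial factors (\<open>gap_prob_upper\<close>, \<open>gap_prob_lower\<close>); the
  larger tail, that is the smaller rate, decides. For the remaining \<open>j\<close> one of the tails is at worst
  polynomially small, and for \<open>s\<^sub>j \<ge> 9 R\<close> the numbers \<open>\<lambda>\<^sub>j\<close> are summable uniformly in \<open>R\<close>. As the \<open>s\<^sub>j / R\<close>
  are spaced by \<open>2 / (\<alpha> R)\<close>, the sum is a Riemann sum: divided by \<open>R\<^sup>2 = r\<^sup>2\<^sup>\<alpha>\<close> it tends to \<open>- \<alpha> / 2\<close> times the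
  integral over \<open>[q, 1]\<close> of the smaller rate. The two rates cross at \<open>u = (1 - q) / (- ln q)\<close>, and the
  integral is elementary (\<open>integral_gap_rate\<close>).
\<close>


section \<open>Elementary symmetric sums over injective maps\<close>

text \<open>The injective maps from \<open>{..<k}\<close> to \<open>C\<close>, made \<^const>\<open>undefined\<close> outside \<open>{..<k}\<close> so that they form a
  finite set. The sum of \<open>\<Prod>i<k. g (f i)\<close> over them is \<open>k!\<close> times the \<open>k\<close>-th elementary symmetric function.\<close>

definition inj_maps :: "nat \<Rightarrow> 'a set \<Rightarrow> (nat \<Rightarrow> 'a) set" where
  "inj_maps k C = {f \<in> {..<k} \<rightarrow>\<^sub>E C. inj_on f {..<k}}"

lemma finite_inj_maps: "finite C \<Longrightarrow> finite (inj_maps k C)"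
  unfolding inj_maps_def by (simp add: finite_PiE)

lemma inj_maps_empty: "finite C \<Longrightarrow> card C < k \<Longrightarrow> inj_maps k C = {}"
  unfolding inj_maps_def using card_inj[of _ "{..<k}" C] by (auto simp: PiE_def not_less)

lemma card_inj_maps: 
  assumes "finite B" "card B = k"
  shows "card (inj_maps k B) = fact k"
  unfolding inj_maps_def
  using card_inj_on_subset_funcset[of "{..<k}" B "{..<k}"] assms
  by (simp add: fact_prod_rev lessThan_atLeast0)

lemma sum_inj_maps:
  fixes g :: "'a \<Rightarrow> real"
  assumes "finite C"
  shows "(\<Sum>f\<in>inj_maps k C. \<Prod>i<k. g (f i)) = fact k * (\<Sum>B | B \<subseteq> C \<and> card B = k. \<Prod>c\<in>B. g c)"
proof -
  let ?S = "{B. B \<subseteq> C \<and> card B = k}"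
  have fS: "finite ?S" using assms by simp
  have im: "f ` {..<k} \<subseteq> C \<and> card (f ` {..<k}) = k" if "f \<in> inj_maps k C" for f
    using that by (auto simp: inj_maps_def card_image PiE_def)
  have "(\<Sum>f\<in>inj_maps k C. \<Prod>i<k. g (f i)) =
        (\<Sum>B\<in>?S. \<Sum>f | f \<in> inj_maps k C \<and> f ` {..<k} = B. \<Prod>i<k. g (f i))"
    by (rule sum.group[symmetric]) (use im in \<open>auto intro: finite_inj_maps fS assms\<close>)
  also have "\<dots> = (\<Sum>B\<in>?S. fact k * (\<Prod>c\<in>B. g c))"
  proof (rule sum.cong[OF refl])
    fix B assume B: "B \<in> ?S"
    then have fB: "finite B" using assms finite_subset by auto
    have eq: "{f. f \<in> inj_maps k C \<and> f ` {..<k} = B} = inj_maps k B"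
    proof (intro equalityI subsetI)
      fix f assume f: "f \<in> inj_maps k B"
      then have "f ` {..<k} \<subseteq> B" "card (f ` {..<k}) = card B"
        using B by (auto simp: inj_maps_def card_image)
      then have "f ` {..<k} = B" using fB card_subset_eq by blast
      then show "f \<in> {f. f \<in> inj_maps k C \<and> f ` {..<k} = B}"
        using f B by (auto simp: inj_maps_def PiE_def Pi_def)
    qed (auto simp: inj_maps_def PiE_def)
    have "(\<Sum>f | f \<in> inj_maps k C \<and> f ` {..<k} = B. \<Prod>i<k. g (f i)) = (\<Sum>f\<in>inj_maps k B. \<Prod>c\<in>B. g c)"
    proof (intro sum.cong)
      fix f assume "f \<in> inj_maps k B"
      then have "f \<in> {f. f \<in> inj_maps k C \<and> f ` {..<k} = B}" unfolding eq .
      then have "inj_on f {..<k}" "f ` {..<k} = B" by (auto simp: inj_maps_def)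
      then show "(\<Prod>i<k. g (f i)) = (\<Prod>c\<in>B. g c)"
        using prod.reindex[of f "{..<k}" g] by simp
    qed (use eq in auto)
    also have "\<dots> = fact k * (\<Prod>c\<in>B. g c)"
      using card_inj_maps[OF fB] B by simp
    finally show "(\<Sum>f | f \<in> inj_maps k C \<and> f ` {..<k} = B. \<Prod>i<k. g (f i)) = fact k * (\<Prod>c\<in>B. g c)" .
  qed
  also have "\<dots> = fact k * (\<Sum>B\<in>?S. \<Prod>c\<in>B. g c)" by (simp add: sum_distrib_left)
  finally show ?thesis .
qed

lemma prod_one_plus_inj_maps:
  fixes g :: "'a \<Rightarrow> real"
  assumes "finite C"
  shows "(\<Prod>c\<in>C. 1 + t * g c) = (\<Sum>k\<le>card C. t ^ k / fact k * (\<Sum>f\<in>inj_maps k C. \<Prod>i<k. g (f i)))"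
proof -
  have "(\<Prod>c\<in>C. 1 + t * g c) = (\<Sum>B\<in>Pow C. \<Prod>c\<in>B. t * g c)"
    using prod_add[OF assms, of "\<lambda>c. t * g c" "\<lambda>_. 1"] by (simp add: add.commute)
  also have "\<dots> = (\<Sum>k\<le>card C. \<Sum>B | B \<in> Pow C \<and> card B = k. \<Prod>c\<in>B. t * g c)"
    by (rule sum.group[symmetric]) (use assms card_mono in auto)
  also have "\<dots> = (\<Sum>k\<le>card C. t ^ k * (\<Sum>B | B \<subseteq> C \<and> card B = k. \<Prod>c\<in>B. g c))"
    by (intro sum.cong refl) (auto simp: sum_distrib_left prod.distrib intro!: sum.cong)
  also have "\<dots> = (\<Sum>k\<le>card C. t ^ k / fact k * (\<Sum>f\<in>inj_maps k C. \<Prod>i<k. g (f i)))"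
    by (intro sum.cong refl) (simp add: sum_inj_maps[OF assms])
  finally show ?thesis .
qed

lemma prod_one_plus_inj_maps_sums:
  fixes g :: "'a \<Rightarrow> real"
  assumes "finite C"
  shows "(\<lambda>k. t ^ k / fact k * (\<Sum>f\<in>inj_maps k C. \<Prod>i<k. g (f i))) sums (\<Prod>c\<in>C. 1 + t * g c)"
  unfolding prod_one_plus_inj_maps[OF assms]
  by (rule sums_finite) (simp_all add: inj_maps_empty assms)

section \<open>Dyadic partitions of the plane\<close>

text \<open>The index of the half-open dyadic square of side \<open>2\<^sup>-\<^sup>n\<close> that contains \<open>z\<close>.\<close>

definition dyadic_cell :: "nat \<Rightarrow> complex \<Rightarrow> int \<times> int" where
  "dyadic_cell n z = (\<lfloor>2 ^ n * Re z\<rfloor>, \<lfloor>2 ^ n * Im z\<rfloor>)"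

lemma dyadic_cell_mono:
  assumes "n \<le> m" "dyadic_cell m z = dyadic_cell m w"
  shows "dyadic_cell n z = dyadic_cell n w"
proof -
  have *: "\<lfloor>2 ^ n * x\<rfloor> = \<lfloor>2 ^ m * x\<rfloor> div 2 ^ (m - n)" for x :: real
  proof -
    have "\<lfloor>2 ^ n * x\<rfloor> = \<lfloor>(2 ^ m * x) / real_of_int (2 ^ (m - n))\<rfloor>"
    proof -
      have "(2::real) ^ m = 2 ^ n * 2 ^ (m - n)" using assms(1) by (simp flip: power_add)
      then show ?thesis by simp
    qed
    also have "\<dots> = \<lfloor>2 ^ m * x\<rfloor> div 2 ^ (m - n)"
      by (rule floor_divide_real_eq_div) simp
    finally show ?thesis .
  qed
  show ?thesis using assms(2) by (simp add: dyadic_cell_def *)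
qed

lemma dyadic_cell_separates:
  assumes "z \<noteq> w"
  shows "\<exists>n. dyadic_cell n z \<noteq> dyadic_cell n w"
proof (rule ccontr)
  assume "\<not> ?thesis"
  then have eq: "\<lfloor>2 ^ n * Re z\<rfloor> = \<lfloor>2 ^ n * Re w\<rfloor>" "\<lfloor>2 ^ n * Im z\<rfloor> = \<lfloor>2 ^ n * Im w\<rfloor>" for n
    by (auto simp: dyadic_cell_def)
  have *: "x = y" if "\<And>n. \<lfloor>2 ^ n * x\<rfloor> = \<lfloor>2 ^ n * y\<rfloor>" for x y :: real
  proof (rule ccontr)
    assume "x \<noteq> y"
    then have "\<bar>x - y\<bar> > 0" by simp
    then obtain n where n: "1 / \<bar>x - y\<bar> < 2 ^ n"
      using real_arch_pow[of 2 "1 / \<bar>x - y\<bar>"] by auto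
    have "\<bar>2 ^ n * x - 2 ^ n * y\<bar> < 1"
      using that[of n] by linarith
    then have "2 ^ n * \<bar>x - y\<bar> < 1"
      by (simp add: abs_mult flip: right_diff_distrib)
    then show False using n \<open>\<bar>x - y\<bar> > 0\<close> by (simp add: field_simps)
  qed
  show False using assms *[OF eq(1)] *[OF eq(2)] by (simp add: complex_eq_iff)
qed

lemma dyadic_cell_eventually_inj:
  assumes "finite S"
  shows "\<exists>n0. \<forall>n\<ge>n0. inj_on (dyadic_cell n) S"
proof -
  have "\<exists>N. \<forall>z w. z \<noteq> w \<longrightarrow> dyadic_cell (N z w) z \<noteq> dyadic_cell (N z w) w"
    using dyadic_cell_separates by metis
  then obtain N where N: "\<And>z w. z \<noteq> w \<Longrightarrow> dyadic_cell (N z w) z \<noteq> dyadic_cell (N z w) w" by blast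
  define n0 where "n0 = Max (insert 0 ((\<lambda>(z, w). N z w) ` (S \<times> S)))"
  have "inj_on (dyadic_cell n) S" if "n \<ge> n0" for n
  proof (rule inj_onI, rule ccontr)
    fix z w assume zw: "z \<in> S" "w \<in> S" "dyadic_cell n z = dyadic_cell n w" "z \<noteq> w"
    have "N z w \<le> n0" unfolding n0_def
      using zw assms by (intro Max_ge) (auto intro: rev_image_eqI)
    then show False using dyadic_cell_mono[of "N z w" n z w] N[of z w] zw that by simp
  qed
  then show ?thesis by blast
qed

lemma finite_dyadic_cell_image:
  assumes "bounded A"
  shows "finite (dyadic_cell n ` A)"
proof -
  obtain B where B: "\<And>z. z \<in> A \<Longrightarrow> cmod z \<le> B" using assms by (auto simp: bounded_iff)
  have fl: "\<lfloor>2 ^ n * x\<rfloor> \<in> {\<lfloor>- (2 ^ n * B)\<rfloor>..\<lfloor>2 ^ n * B\<rfloor>}" if "\<bar>x\<bar> \<le> B" for x :: real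
  proof -
    have "\<bar>2 ^ n * x\<bar> \<le> 2 ^ n * B" using that by (simp add: abs_mult)
    then have "- (2 ^ n * B) \<le> 2 ^ n * x" "2 ^ n * x \<le> 2 ^ n * B" by linarith+
    then show ?thesis by (auto intro: floor_mono)
  qed
  have "dyadic_cell n ` A \<subseteq> {\<lfloor>- (2 ^ n * B)\<rfloor>..\<lfloor>2 ^ n * B\<rfloor>} \<times> {\<lfloor>- (2 ^ n * B)\<rfloor>..\<lfloor>2 ^ n * B\<rfloor>}"
    unfolding dyadic_cell_def
    using fl order_trans[OF abs_Re_le_cmod B] order_trans[OF abs_Im_le_cmod B]
    by (intro image_subsetI SigmaI) auto
  then show ?thesis by (rule finite_subset) simp
qed

lemma sets_dyadic_cell:
  assumes "A \<in> sets borel"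
  shows "{z \<in> A. dyadic_cell n z = c} \<in> sets borel"
proof -
  have "{z. dyadic_cell n z = c} = {z \<in> space borel. \<lfloor>2 ^ n * Re z\<rfloor> = fst c \<and> \<lfloor>2 ^ n * Im z\<rfloor> = snd c}"
    by (auto simp: dyadic_cell_def)
  also have "\<dots> \<in> sets borel" by measurable
  finally have "A \<inter> {z. dyadic_cell n z = c} \<in> sets borel" using assms by auto
  then show ?thesis by (simp add: Collect_conj_eq)
qed

lemma sum_card_cells:
  assumes "finite S" "finite C" "p ` S \<subseteq> C"
  shows "(\<Sum>c\<in>C. card {z \<in> S. p z = c}) = card S"
  using sum.group[OF assms, of "\<lambda>_. 1::nat"] by simp

text \<open>In this lemma and the next, \<open>card {z \<in> S. p z = c}\<close> is the number of points in the cell \<open>c\<close>. The bound \<open>2\<^sup>|\<^sup>S\<^sup>|\<close>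
  does not depend on the partition; the product is \<open>(1 + t)\<^sup>|\<^sup>S\<^sup>|\<close> once the cells separate the points.\<close>

lemma prod_cells_le:
  assumes "finite S" "finite C" "p ` S \<subseteq> C"
  shows "(\<Prod>c\<in>C. 1 + real (card {z \<in> S. p z = c})) \<le> 2 ^ card S"
proof -
  have "(\<Prod>c\<in>C. 1 + real (card {z \<in> S. p z = c})) \<le> (\<Prod>c\<in>C. 2 ^ card {z \<in> S. p z = c})"
  proof (rule prod_mono)
    fix c
    have "1 + n \<le> 2 ^ n" for n :: nat by (induct n) auto
    from this[of "card {z \<in> S. p z = c}"]
    have "real (1 + card {z \<in> S. p z = c}) \<le> real (2 ^ card {z \<in> S. p z = c})"
      unfolding of_nat_le_iff .
    then show "0 \<le> 1 + real (card {z \<in> S. p z = c}) \<and>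
        1 + real (card {z \<in> S. p z = c}) \<le> 2 ^ card {z \<in> S. p z = c}"
      by simp
  qed
  also have "\<dots> = 2 ^ card S"
    by (simp add: sum_card_cells[OF assms] flip: power_sum)
  finally show ?thesis .
qed

lemma prod_cells_eq:
  assumes "finite S" "finite C" "p ` S \<subseteq> C" "inj_on p S"
  shows "(\<Prod>c\<in>C. 1 + t * real (card {z \<in> S. p z = c})) = (1 + t) ^ card S"
proof -
  have "card {z \<in> S. p z = c} = (if c \<in> p ` S then 1 else 0)" for c
  proof (cases "c \<in> p ` S")
    case True
    then obtain z where z: "z \<in> S" "c = p z" by auto
    then have "{w \<in> S. p w = c} = {z}" using assms(4) by (auto dest: inj_onD)
    then show ?thesis using True by simp
  next
    case False
    then have "{w \<in> S. p w = c} = {}" by auto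
    then have "card {w \<in> S. p w = c} = 0" by (simp only: card.empty)
    then show ?thesis using False by simp
  qed
  then have "(\<Prod>c\<in>C. 1 + t * real (card {z \<in> S. p z = c})) = (\<Prod>c\<in>C. if c \<in> p ` S then 1 + t else 1)"
    by (intro prod.cong) auto
  also have "\<dots> = (1 + t) ^ card (C \<inter> p ` S)"
    using assms(2) by (simp add: prod.If_cases)
  also have "C \<inter> p ` S = p ` S" using assms by auto
  finally show ?thesis using assms by (simp add: card_image)
qed

section \<open>Void probabilities from joint intensities\<close>

text \<open>Let \<open>N\<close> count the points of the process in \<open>A\<close> and let \<open>J k\<close> be the integral of the \<open>k\<close>-th intensity over
  \<open>A\<^sup>k\<close>, with \<open>J 0 = 1\<close>. For the partition of \<open>A\<close> into dyadic cells of level \<open>n\<close>, with cell counts \<open>N\<^sub>c\<close>, the expectation of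
  \<open>\<Prod>\<^sub>c (1 + t N\<^sub>c)\<close> only involves intensities on products of disjoint sets. As \<open>n\<close> grows the product
  tends to \<open>(1 + t)\<^sup>N\<close>. Fatou's lemma at \<open>t = 1\<close> shows that \<open>2\<^sup>N\<close> is integrable, and dominated convergence
  at \<open>t = -1\<close>, where \<open>0\<^sup>N\<close> is the indicator of \<open>N = 0\<close>, gives the void probability.\<close>

context
  fixes M :: "'w measure" and X :: "'w \<Rightarrow> complex set" and \<rho> :: "nat \<Rightarrow> (nat \<Rightarrow> complex) \<Rightarrow> real"
    and A :: "complex set" and J :: "nat \<Rightarrow> real"
  assumes spp: "simple_point_process M X" and ji: "joint_intensities M X \<rho>"
    and A: "A \<in> sets borel" "bounded A"
    and J0: "J 0 = 1" and Jnn: "\<And>k. 0 \<le> J k"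
    and J: "\<And>k. k \<ge> 1 \<Longrightarrow>
      (\<integral>\<^sup>+x\<in>Pi\<^sub>E {..<k} (\<lambda>_. A). ennreal (\<rho> k x) \<partial>(Pi\<^sub>M {..<k} (\<lambda>_. lborel))) = ennreal (J k)"
begin

interpretation prob_space M using spp by (simp add: simple_point_process_def)

text \<open>The part of \<open>A\<close> in the dyadic square with index \<open>c\<close>, and the finite set of indices that occur in \<open>A\<close>.\<close>

definition cell :: "nat \<Rightarrow> int \<times> int \<Rightarrow> complex set" where
  "cell n c = {z \<in> A. dyadic_cell n z = c}"

definition cells :: "nat \<Rightarrow> (int \<times> int) set" where
  "cells n = dyadic_cell n ` A"

text \<open>The expected number of ordered \<open>k\<close>-tuples of points in pairwise distinct cells of level \<open>n\<close>.\<close>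

definition cell_moment :: "nat \<Rightarrow> nat \<Rightarrow> real" where
  "cell_moment n k = (\<Sum>f\<in>inj_maps k (cells n). \<integral>\<omega>. (\<Prod>i<k. real (num_points X (cell n (f i)) \<omega>)) \<partial>M)"

lemma finite_cells: "finite (cells n)"
  unfolding cells_def by (rule finite_dyadic_cell_image[OF A(2)])

lemma sets_cell: "cell n c \<in> sets borel" "bounded (cell n c)"
  unfolding cell_def using A sets_dyadic_cell bounded_subset[of A] by auto

lemma measurable_num_points:
  "B \<in> sets borel \<Longrightarrow> bounded B \<Longrightarrow> num_points X B \<in> measurable M (count_space UNIV)"
  using spp by (auto simp: simple_point_process_def)

lemma measurable_real_num_points:
  "B \<in> sets borel \<Longrightarrow> bounded B \<Longrightarrow> (\<lambda>\<omega>. real (num_points X B \<omega>)) \<in> borel_measurable M"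
  using measurable_num_points by (rule measurable_compose) simp_all

text \<open>The measure on \<open>k\<close>-tuples with density \<open>\<rho> k\<close> on \<open>A\<^sup>k\<close>.\<close>

definition intensity_measure :: "nat \<Rightarrow> (nat \<Rightarrow> complex) measure" where
  "intensity_measure k = density (Pi\<^sub>M {..<k} (\<lambda>_. lborel))
     (\<lambda>x. ennreal (\<rho> k x) * indicator (Pi\<^sub>E {..<k} (\<lambda>_. A)) x)"

lemma rho_measurable: "k \<ge> 1 \<Longrightarrow> \<rho> k \<in> borel_measurable (Pi\<^sub>M {..<k} (\<lambda>_. lborel))"
  using ji by (auto simp: joint_intensities_def)

lemma PiE_sets: "(\<And>i. i < (k::nat) \<Longrightarrow> D i \<in> sets borel) \<Longrightarrow> Pi\<^sub>E {..<k} D \<in> sets (Pi\<^sub>M {..<k} (\<lambda>_. lborel :: complex measure))"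
  by (intro sets_PiM_I_finite) auto

lemma emeasure_intensity_measure:
  assumes "k \<ge> 1" "S \<in> sets (Pi\<^sub>M {..<k} (\<lambda>_. lborel))" "S \<subseteq> Pi\<^sub>E {..<k} (\<lambda>_. A)"
  shows "emeasure (intensity_measure k) S = (\<integral>\<^sup>+x\<in>S. ennreal (\<rho> k x) \<partial>(Pi\<^sub>M {..<k} (\<lambda>_. lborel)))"
proof -
  have "(\<lambda>x. ennreal (\<rho> k x) * indicator (Pi\<^sub>E {..<k} (\<lambda>_. A)) x) \<in> borel_measurable (Pi\<^sub>M {..<k} (\<lambda>_. lborel))"
    using rho_measurable[OF assms(1)] PiE_sets[of k "\<lambda>_. A"] A by measurable
  then have "emeasure (intensity_measure k) S =
      (\<integral>\<^sup>+x. (ennreal (\<rho> k x) * indicator (Pi\<^sub>E {..<k} (\<lambda>_. A)) x) * indicator S x \<partial>(Pi\<^sub>M {..<k} (\<lambda>_. lborel)))"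
    unfolding intensity_measure_def using assms(2) by (rule emeasure_density)
  also have "\<dots> = (\<integral>\<^sup>+x\<in>S. ennreal (\<rho> k x) \<partial>(Pi\<^sub>M {..<k} (\<lambda>_. lborel)))"
    using assms(3) by (intro nn_integral_cong) (auto simp: indicator_def)
  finally show ?thesis .
qed

lemma sets_intensity_measure: "sets (intensity_measure k) = sets (Pi\<^sub>M {..<k} (\<lambda>_. lborel))"
  by (simp add: intensity_measure_def)

lemma finite_intensity_measure:
  assumes "k \<ge> 1"
  shows "emeasure (intensity_measure k) (space (intensity_measure k)) = ennreal (J k)"
proof -
  have m: "(\<lambda>x. ennreal (\<rho> k x) * indicator (Pi\<^sub>E {..<k} (\<lambda>_. A)) x) \<in> borel_measurable (Pi\<^sub>M {..<k} (\<lambda>_. lborel))"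
    using rho_measurable[OF assms(1)] PiE_sets[of k "\<lambda>_. A"] A by measurable
  have "emeasure (intensity_measure k) (space (intensity_measure k)) =
      (\<integral>\<^sup>+x. (ennreal (\<rho> k x) * indicator (Pi\<^sub>E {..<k} (\<lambda>_. A)) x) *
        indicator (space (Pi\<^sub>M {..<k} (\<lambda>_. lborel))) x \<partial>(Pi\<^sub>M {..<k} (\<lambda>_. lborel)))"
    unfolding intensity_measure_def space_density by (rule emeasure_density[OF m sets.top])
  also have "\<dots> = (\<integral>\<^sup>+x\<in>Pi\<^sub>E {..<k} (\<lambda>_. A). ennreal (\<rho> k x) \<partial>(Pi\<^sub>M {..<k} (\<lambda>_. lborel)))"
    by (intro nn_integral_cong) simp
  finally show ?thesis using J[OF assms] by simp
qed

lemma cell_product: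
  assumes "k \<ge> 1" "f \<in> inj_maps k (cells n)"
  shows "integrable M (\<lambda>\<omega>. \<Prod>i<k. real (num_points X (cell n (f i)) \<omega>))"
    and "(\<integral>\<omega>. (\<Prod>i<k. real (num_points X (cell n (f i)) \<omega>)) \<partial>M) =
         measure (intensity_measure k) (Pi\<^sub>E {..<k} (\<lambda>i. cell n (f i)))"
proof -
  let ?P = "\<lambda>\<omega>. \<Prod>i<k. real (num_points X (cell n (f i)) \<omega>)"
  let ?D = "\<lambda>i. cell n (f i)"
  have disj: "disjoint_family_on ?D {..<k}"
    using assms(2) by (auto simp: disjoint_family_on_def inj_maps_def cell_def dest: inj_onD)
  have sub: "Pi\<^sub>E {..<k} ?D \<subseteq> Pi\<^sub>E {..<k} (\<lambda>_. A)"
    by (intro PiE_mono) (auto simp: cell_def)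
  have S: "Pi\<^sub>E {..<k} ?D \<in> sets (Pi\<^sub>M {..<k} (\<lambda>_. lborel))"
    using sets_cell by (intro PiE_sets) auto
  have "(\<integral>\<^sup>+\<omega>. ennreal (?P \<omega>) \<partial>M) = (\<integral>\<^sup>+x\<in>Pi\<^sub>E {..<k} ?D. ennreal (\<rho> k x) \<partial>(Pi\<^sub>M {..<k} (\<lambda>_. lborel)))"
    using ji[unfolded joint_intensities_def, rule_format, OF assms(1), THEN conjunct2, THEN conjunct2,
        THEN conjunct2, rule_format, of ?D] disj sets_cell by simp
  also have "\<dots> = emeasure (intensity_measure k) (Pi\<^sub>E {..<k} ?D)"
    using emeasure_intensity_measure[OF assms(1) S sub] by simp
  finally have eq: "(\<integral>\<^sup>+\<omega>. ennreal (?P \<omega>) \<partial>M) = emeasure (intensity_measure k) (Pi\<^sub>E {..<k} ?D)" .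
  have m: "?P \<in> borel_measurable M"
    by (intro borel_measurable_prod measurable_real_num_points sets_cell)
  have "emeasure (intensity_measure k) (Pi\<^sub>E {..<k} ?D) \<le> ennreal (J k)"
    using emeasure_space[of "intensity_measure k" "Pi\<^sub>E {..<k} ?D"]
    unfolding finite_intensity_measure[OF assms(1)] .
  then have fin: "emeasure (intensity_measure k) (Pi\<^sub>E {..<k} ?D) < \<infinity>"
    by (simp add: order_le_less_trans)
  show "integrable M ?P"
    using m fin eq by (intro integrableI_bounded) (simp_all add: prod_nonneg)
  show "integral\<^sup>L M ?P = measure (intensity_measure k) (Pi\<^sub>E {..<k} ?D)"
    using m eq by (subst integral_eq_nn_integral) (auto simp: prod_nonneg measure_def)
qed

lemma integrable_cell_product:
  "f \<in> inj_maps k (cells n) \<Longrightarrow> integrable M (\<lambda>\<omega>. \<Prod>i<k. real (num_points X (cell n (f i)) \<omega>))"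
  using cell_product(1)[of k f n] by (cases "k = 0") auto

lemma cell_moment_eq:
  assumes "k \<ge> 1"
  shows "cell_moment n k = measure (intensity_measure k)
    {x \<in> Pi\<^sub>E {..<k} (\<lambda>_. A). inj_on (\<lambda>i. dyadic_cell n (x i)) {..<k}}"
    and "{x \<in> Pi\<^sub>E {..<k} (\<lambda>_. A). inj_on (\<lambda>i. dyadic_cell n (x i)) {..<k}} \<in> sets (intensity_measure k)"
proof -
  let ?E = "{x \<in> Pi\<^sub>E {..<k} (\<lambda>_. A). inj_on (\<lambda>i. dyadic_cell n (x i)) {..<k}}"
  let ?I = "inj_maps k (cells n)"
  let ?B = "\<lambda>f. Pi\<^sub>E {..<k} (\<lambda>i. cell n (f i))"
  interpret finite_measure "intensity_measure k"
    by (rule finite_measureI) (simp add: finite_intensity_measure[OF assms])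
  have S: "?B f \<in> sets (intensity_measure k)" for f
    unfolding sets_intensity_measure using sets_cell by (intro PiE_sets) auto
  have eqE: "?E = (\<Union>f\<in>?I. ?B f)"
  proof (intro equalityI subsetI)
    fix x assume x: "x \<in> ?E"
    define f where "f = restrict (\<lambda>i. dyadic_cell n (x i)) {..<k}"
    have "f \<in> ?I" using x by (auto simp: f_def inj_maps_def cells_def inj_on_def PiE_def Pi_def)
    moreover have "x \<in> ?B f" using x by (auto simp: f_def cell_def PiE_def Pi_def)
    ultimately show "x \<in> (\<Union>f\<in>?I. ?B f)" by blast
  next
    fix x assume "x \<in> (\<Union>f\<in>?I. ?B f)"
    then show "x \<in> ?E" by (auto simp: inj_maps_def cell_def inj_on_def PiE_def Pi_def)
  qed
  have disj: "disjoint_family_on ?B ?I"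
    unfolding disjoint_family_on_def
  proof (intro ballI impI)
    fix f g assume fg: "f \<in> ?I" "g \<in> ?I" "f \<noteq> g"
    then have "f \<in> {..<k} \<rightarrow>\<^sub>E cells n" "g \<in> {..<k} \<rightarrow>\<^sub>E cells n" by (auto simp: inj_maps_def)
    from PiE_ext[OF this] fg(3) obtain i where i: "i < k" "f i \<noteq> g i" by auto
    show "?B f \<inter> ?B g = {}"
    proof (rule equals0I)
      fix x assume "x \<in> ?B f \<inter> ?B g"
      then have "x i \<in> cell n (f i)" "x i \<in> cell n (g i)" using i by auto
      then show False using i by (simp add: cell_def)
    qed
  qed
  show "?E \<in> sets (intensity_measure k)" unfolding eqE
    using S finite_inj_maps[OF finite_cells] by blast
  have "cell_moment n k = (\<Sum>f\<in>?I. measure (intensity_measure k) (?B f))"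
    unfolding cell_moment_def by (intro sum.cong refl cell_product(2)) (use assms in auto)
  also have "\<dots> = measure (intensity_measure k) (\<Union>f\<in>?I. ?B f)"
    by (rule finite_measure_finite_Union[symmetric]) (use S disj finite_inj_maps[OF finite_cells] in auto)
  finally show "cell_moment n k = measure (intensity_measure k) ?E" unfolding eqE .
qed

lemma cell_moment_0: "cell_moment n 0 = 1"
  by (simp add: cell_moment_def inj_maps_def prob_space)

lemma cell_moment_bounds: "0 \<le> cell_moment n k" "cell_moment n k \<le> J k"
proof -
  have "0 \<le> cell_moment n k \<and> cell_moment n k \<le> J k"
  proof (cases "k = 0")
    case False
    then have k: "k \<ge> 1" by simp
    interpret finite_measure "intensity_measure k"
      by (rule finite_measureI) (simp add: finite_intensity_measure[OF k])
    have "measure (intensity_measure k) (space (intensity_measure k)) = J k"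
      using finite_intensity_measure[OF k] Jnn by (simp add: measure_def)
    then show ?thesis
      using bounded_measure cell_moment_eq(1)[OF k, of n] by (simp add: measure_nonneg)
  qed (simp add: cell_moment_0 J0)
  then show "0 \<le> cell_moment n k" "cell_moment n k \<le> J k" by auto
qed

text \<open>The tuples in distinct cells increase to the tuples of distinct points, and the intensity vanishes
  on all other tuples.\<close>

lemma cell_moment_tendsto: "(\<lambda>n. cell_moment n k) \<longlonglongrightarrow> J k"
proof (cases "k = 0")
  case False
  then have k: "k \<ge> 1" by simp
  let ?A = "Pi\<^sub>E {..<k} (\<lambda>_. A)"
  let ?E = "\<lambda>n. {x \<in> ?A. inj_on (\<lambda>i. dyadic_cell n (x i)) {..<k}}"
  interpret finite_measure "intensity_measure k"
    by (rule finite_measureI) (simp add: finite_intensity_measure[OF k])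
  have inc: "incseq ?E"
  proof (rule incseq_SucI, rule subsetI)
    fix n x assume x: "x \<in> ?E n"
    have "inj_on (\<lambda>i. dyadic_cell (Suc n) (x i)) {..<k}"
    proof (rule inj_onI)
      fix i j assume ij: "i \<in> {..<k}" "j \<in> {..<k}" "dyadic_cell (Suc n) (x i) = dyadic_cell (Suc n) (x j)"
      then have "dyadic_cell n (x i) = dyadic_cell n (x j)" by (intro dyadic_cell_mono[of n "Suc n"]) auto
      then show "i = j" using x ij by (auto dest: inj_onD)
    qed
    then show "x \<in> ?E (Suc n)" using x by simp
  qed
  have un: "(\<Union>n. ?E n) = {x \<in> ?A. inj_on x {..<k}}"
  proof (intro equalityI subsetI)
    fix x assume "x \<in> {x \<in> ?A. inj_on x {..<k}}"
    then have x: "x \<in> ?A" "inj_on x {..<k}" by auto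
    obtain n where "inj_on (dyadic_cell n) (x ` {..<k})"
      using dyadic_cell_eventually_inj[of "x ` {..<k}"] by auto
    then have "inj_on (\<lambda>i. dyadic_cell n (x i)) {..<k}"
      using x(2) comp_inj_on[of x "{..<k}" "dyadic_cell n"] by (simp add: o_def)
    then show "x \<in> (\<Union>n. ?E n)" using x by blast
  next
    fix x assume "x \<in> (\<Union>n. ?E n)"
    then obtain n where n: "x \<in> ?A" "inj_on (\<lambda>i. dyadic_cell n (x i)) {..<k}" by blast
    have "inj_on x {..<k}"
    proof (rule inj_onI)
      fix i j assume "i \<in> {..<k}" "j \<in> {..<k}" "x i = x j"
      then show "i = j" using inj_onD[OF n(2), of i j] by simp
    qed
    then show "x \<in> {x \<in> ?A. inj_on x {..<k}}" using n(1) by simp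
  qed
  have lim: "(\<lambda>n. measure (intensity_measure k) (?E n)) \<longlonglongrightarrow> measure (intensity_measure k) (\<Union>n. ?E n)"
    using inc cell_moment_eq(2)[OF k] by (intro finite_Lim_measure_incseq) auto
  have U: "(\<Union>n. ?E n) \<in> sets (Pi\<^sub>M {..<k} (\<lambda>_. lborel))"
    using cell_moment_eq(2)[OF k] unfolding sets_intensity_measure by blast
  have "emeasure (intensity_measure k) (\<Union>n. ?E n) =
      (\<integral>\<^sup>+x\<in>(\<Union>n. ?E n). ennreal (\<rho> k x) \<partial>(Pi\<^sub>M {..<k} (\<lambda>_. lborel)))"
    by (rule emeasure_intensity_measure[OF k U]) auto
  also have "\<dots> = (\<integral>\<^sup>+x\<in>?A. ennreal (\<rho> k x) \<partial>(Pi\<^sub>M {..<k} (\<lambda>_. lborel)))"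
  proof (rule nn_integral_cong)
    fix x :: "nat \<Rightarrow> complex"
    have "\<not> inj_on x {..<k} \<Longrightarrow> \<rho> k x = 0" using ji k by (auto simp: joint_intensities_def)
    then show "ennreal (\<rho> k x) * indicator (\<Union>n. ?E n) x = ennreal (\<rho> k x) * indicator ?A x"
      unfolding un by (auto simp: indicator_def)
  qed
  also have "\<dots> = ennreal (J k)" by (rule J[OF k])
  finally have "measure (intensity_measure k) (\<Union>n. ?E n) = J k" using Jnn by (simp add: measure_def)
  then show ?thesis using lim by (simp add: cell_moment_eq(1)[OF k])
qed (simp add: cell_moment_0 J0)

lemma exponential_moment:
  "integrable M (\<lambda>\<omega>. \<Prod>c\<in>cells n. 1 + t * real (num_points X (cell n c) \<omega>))"
  "(\<lambda>k. t ^ k / fact k * cell_moment n k) sums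
     (\<integral>\<omega>. (\<Prod>c\<in>cells n. 1 + t * real (num_points X (cell n c) \<omega>)) \<partial>M)"
proof -
  have eq: "(\<Prod>c\<in>cells n. 1 + t * real (num_points X (cell n c) \<omega>)) = 
    (\<Sum>k\<le>card (cells n). t ^ k / fact k *
       (\<Sum>f\<in>inj_maps k (cells n). \<Prod>i<k. real (num_points X (cell n (f i)) \<omega>)))" for \<omega>
    by (rule prod_one_plus_inj_maps[OF finite_cells])
  show "integrable M (\<lambda>\<omega>. \<Prod>c\<in>cells n. 1 + t * real (num_points X (cell n c) \<omega>))"
    unfolding eq by (intro Bochner_Integration.integrable_sum integrable_mult_right integrable_cell_product)
  have "(\<integral>\<omega>. (\<Prod>c\<in>cells n. 1 + t * real (num_points X (cell n c) \<omega>)) \<partial>M) =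
     (\<Sum>k\<le>card (cells n). t ^ k / fact k * cell_moment n k)"
    unfolding eq cell_moment_def
    by (simp add: Bochner_Integration.integral_sum integrable_cell_product
          Bochner_Integration.integrable_sum)
  moreover have "(\<lambda>k. t ^ k / fact k * cell_moment n k) sums (\<Sum>k\<le>card (cells n). t ^ k / fact k * cell_moment n k)"
    by (rule sums_finite) (simp_all add: cell_moment_def inj_maps_empty finite_cells)
  ultimately show "(\<lambda>k. t ^ k / fact k * cell_moment n k) sums
     (\<integral>\<omega>. (\<Prod>c\<in>cells n. 1 + t * real (num_points X (cell n c) \<omega>)) \<partial>M)" by simp
qed

lemma num_points_cell: "num_points X (cell n c) \<omega> = card {z \<in> X \<omega> \<inter> A. dyadic_cell n z = c}"
  unfolding num_points_def cell_def by (rule arg_cong[of _ _ card]) auto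

lemma finite_points: "\<omega> \<in> space M \<Longrightarrow> finite (X \<omega> \<inter> A)"
  using spp A by (auto simp: simple_point_process_def)

lemma cell_product_tendsto:
  assumes "\<omega> \<in> space M"
  shows "(\<lambda>n. \<Prod>c\<in>cells n. 1 + t * real (num_points X (cell n c) \<omega>)) \<longlonglongrightarrow> (1 + t) ^ num_points X A \<omega>"
proof -
  obtain n0 where n0: "\<And>n. n \<ge> n0 \<Longrightarrow> inj_on (dyadic_cell n) (X \<omega> \<inter> A)"
    using dyadic_cell_eventually_inj[OF finite_points[OF assms]] by auto
  have "(\<Prod>c\<in>cells n. 1 + t * real (num_points X (cell n c) \<omega>)) = (1 + t) ^ num_points X A \<omega>" if "n \<ge> n0" for n
    unfolding num_points_cell unfolding num_points_def
    by (rule prod_cells_eq) (use finite_points[OF assms] finite_cells n0[OF that] in \<open>auto simp: cells_def\<close>)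
  then show ?thesis by (intro tendsto_eventually eventually_sequentiallyI)
qed

lemma cell_product_bound:
  assumes "\<omega> \<in> space M" "\<bar>t\<bar> \<le> 1"
  shows "\<bar>\<Prod>c\<in>cells n. 1 + t * real (num_points X (cell n c) \<omega>)\<bar> \<le> 2 ^ num_points X A \<omega>"
proof -
  have "\<bar>\<Prod>c\<in>cells n. 1 + t * real (num_points X (cell n c) \<omega>)\<bar> \<le>
      (\<Prod>c\<in>cells n. 1 + real (num_points X (cell n c) \<omega>))"
    unfolding abs_prod
  proof (rule prod_mono)
    fix c
    have "\<bar>t * real (num_points X (cell n c) \<omega>)\<bar> \<le> 1 * real (num_points X (cell n c) \<omega>)"
      unfolding abs_mult using assms(2) by (intro mult_mono) auto
    then show "0 \<le> \<bar>1 + t * real (num_points X (cell n c) \<omega>)\<bar> \<and>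
      \<bar>1 + t * real (num_points X (cell n c) \<omega>)\<bar> \<le> 1 + real (num_points X (cell n c) \<omega>)" by linarith
  qed
  also have "\<dots> \<le> 2 ^ num_points X A \<omega>"
    unfolding num_points_cell unfolding num_points_def
    by (rule prod_cells_le) (use finite_points[OF assms(1)] finite_cells in \<open>auto simp: cells_def\<close>)
  finally show ?thesis .
qed

lemma integrable_two_power:
  assumes "summable (\<lambda>k. J k / fact k)"
  shows "integrable M (\<lambda>\<omega>. 2 ^ num_points X A \<omega> :: real)"
proof (rule integrableI_nonneg)
  let ?G = "\<lambda>n \<omega>. \<Prod>c\<in>cells n. 1 + 1 * real (num_points X (cell n c) \<omega>)"
  show "(\<lambda>\<omega>. 2 ^ num_points X A \<omega> :: real) \<in> borel_measurable M"
    using measurable_num_points[OF A] by (rule measurable_compose) simp_all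
  have Gnn: "0 \<le> ?G n \<omega>" for n \<omega> by (intro prod_nonneg) auto
  have le: "(\<integral>\<^sup>+\<omega>. ennreal (?G n \<omega>) \<partial>M) \<le> ennreal (\<Sum>k. J k / fact k)" for n
  proof -
    have "(\<integral>\<^sup>+\<omega>. ennreal (?G n \<omega>) \<partial>M) = ennreal (\<integral>\<omega>. ?G n \<omega> \<partial>M)"
      by (intro nn_integral_eq_integral exponential_moment(1)) (use Gnn in auto)
    also have "(\<integral>\<omega>. ?G n \<omega> \<partial>M) = (\<Sum>k. 1 ^ k / fact k * cell_moment n k)"
      by (rule sums_unique[OF exponential_moment(2)])
    also have "\<dots> \<le> (\<Sum>k. J k / fact k)"
      by (intro suminf_le sums_summable[OF exponential_moment(2)] assms)
         (use cell_moment_bounds in \<open>auto simp: divide_right_mono\<close>)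
    finally show ?thesis by (simp add: ennreal_leI)
  qed
  have "(\<integral>\<^sup>+\<omega>. ennreal (2 ^ num_points X A \<omega>) \<partial>M) = (\<integral>\<^sup>+\<omega>. liminf (\<lambda>n. ennreal (?G n \<omega>)) \<partial>M)"
  proof (rule nn_integral_cong)
    fix \<omega> assume "\<omega> \<in> space M"
    then have "(\<lambda>n. ennreal (?G n \<omega>)) \<longlonglongrightarrow> ennreal ((1 + 1) ^ num_points X A \<omega>)"
      by (intro tendsto_ennrealI cell_product_tendsto)
    then show "ennreal (2 ^ num_points X A \<omega>) = liminf (\<lambda>n. ennreal (?G n \<omega>))"
      by (simp add: lim_imp_Liminf)
  qed
  also have "\<dots> \<le> liminf (\<lambda>n. \<integral>\<^sup>+\<omega>. ennreal (?G n \<omega>) \<partial>M)"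
    by (intro nn_integral_liminf measurable_compose[OF borel_measurable_integrable measurable_ennreal]
          exponential_moment(1))
  also have "\<dots> \<le> limsup (\<lambda>n. \<integral>\<^sup>+\<omega>. ennreal (?G n \<omega>) \<partial>M)" by (rule Liminf_le_Limsup) simp
  also have "\<dots> \<le> ennreal (\<Sum>k. J k / fact k)"
    by (intro Limsup_bounded always_eventually allI le)
  finally show "(\<integral>\<^sup>+\<omega>. ennreal (2 ^ num_points X A \<omega>) \<partial>M) < \<infinity>" by (simp add: order_le_less_trans)
qed auto

theorem void_probability:
  assumes "summable (\<lambda>k. J k / fact k)"
  shows "measure M {\<omega> \<in> space M. num_points X A \<omega> = 0} = (\<Sum>k. (- 1) ^ k / fact k * J k)"
proof -
  let ?G = "\<lambda>n \<omega>. \<Prod>c\<in>cells n. 1 + (- 1) * real (num_points X (cell n c) \<omega>)"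
  have "{\<omega> \<in> space M. num_points X A \<omega> = 0} = num_points X A -` {0} \<inter> space M" by auto
  then have mA: "{\<omega> \<in> space M. num_points X A \<omega> = 0} \<in> sets M"
    using measurable_sets[OF measurable_num_points[OF A], of "{0}"] by simp
  let ?I = "indicator {\<omega> \<in> space M. num_points X A \<omega> = 0} :: 'w \<Rightarrow> real"
  have lim: "(\<lambda>n. ?G n \<omega>) \<longlonglongrightarrow> ?I \<omega>" if "\<omega> \<in> space M" for \<omega>
  proof -
    have *: "(1 + (- 1)) ^ num_points X A \<omega> = ?I \<omega>"
      using that by (simp add: indicator_def power_0_left)
    show ?thesis using cell_product_tendsto[OF that, of "- 1"] unfolding * .
  qed
  have bound: "norm (?G n \<omega>) \<le> 2 ^ num_points X A \<omega>" if "\<omega> \<in> space M" for n \<omega>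
    using cell_product_bound[OF that, of "- 1" n] by simp
  have "(\<lambda>n. \<integral>\<omega>. ?G n \<omega> \<partial>M) \<longlonglongrightarrow> (\<integral>\<omega>. ?I \<omega> \<partial>M)"
  proof (rule integral_dominated_convergence[where s = ?G and w = "\<lambda>\<omega>. 2 ^ num_points X A \<omega>"])
    show "?I \<in> borel_measurable M" by (rule borel_measurable_indicator[OF mA])
    show "?G n \<in> borel_measurable M" for n
      using exponential_moment(1)[where n = n and t = "- 1"] by (rule borel_measurable_integrable)
    show "integrable M (\<lambda>\<omega>. 2 ^ num_points X A \<omega> :: real)" by (rule integrable_two_power[OF assms])
    show "AE \<omega> in M. (\<lambda>n. ?G n \<omega>) \<longlonglongrightarrow> ?I \<omega>" by (rule AE_I2) (rule lim)
    show "\<And>n. AE \<omega> in M. norm (?G n \<omega>) \<le> 2 ^ num_points X A \<omega>" by (rule AE_I2) (rule bound)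
  qed
  moreover have "(\<integral>\<omega>. ?G n \<omega> \<partial>M) = (\<Sum>k. (- 1) ^ k / fact k * cell_moment n k)" for n
    by (rule sums_unique[OF exponential_moment(2)])
  ultimately have 1: "(\<lambda>n. \<Sum>k. (- 1) ^ k / fact k * cell_moment n k) \<longlonglongrightarrow>
      measure M {\<omega> \<in> space M. num_points X A \<omega> = 0}"
    using mA by (simp add: Int_absorb1 sets.sets_into_space)
  have "(\<lambda>n. \<Sum>k. (- 1) ^ k / fact k * cell_moment n k) \<longlonglongrightarrow> (\<Sum>k. (- 1) ^ k / fact k * J k)"
  proof (rule tannerys_theorem[THEN conjunct2, THEN conjunct2])
    show "(\<lambda>n. (- 1) ^ k / fact k * cell_moment n k) \<longlonglongrightarrow> (- 1) ^ k / fact k * J k" for k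
      by (intro tendsto_intros cell_moment_tendsto)
    show "\<forall>\<^sub>F (k, n) in at_top \<times>\<^sub>F sequentially.
        norm ((- 1) ^ k / fact k * cell_moment n k) \<le> J k / fact k"
      using cell_moment_bounds by (intro always_eventually) (auto simp: abs_mult divide_right_mono)
  qed (use assms in auto)
  with 1 show ?thesis by (rule LIMSEQ_unique)
qed

end

section \<open>Rotation invariance of planar Lebesgue measure\<close>

lemma measurable_Complex_pair: "(\<lambda>(x, y). Complex x y) \<in> measurable (lborel \<Otimes>\<^sub>M lborel) borel"
proof -
  have "continuous_on UNIV (\<lambda>p. complex_of_real (fst p) + \<i> * complex_of_real (snd p))"
    by (intro continuous_intros)
  then have "(\<lambda>p. complex_of_real (fst p) + \<i> * complex_of_real (snd p)) \<in> borel_measurable borel"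
    by (rule borel_measurable_continuous_onI)
  moreover have "(\<lambda>p. complex_of_real (fst p) + \<i> * complex_of_real (snd p)) = (\<lambda>(x, y). Complex x y)"
    by (auto simp: fun_eq_iff complex_eq_iff)
  ultimately show ?thesis unfolding lborel_prod by simp
qed

lemma lborel_complex_eq_distr_pair:
  "(lborel :: complex measure) = distr (lborel \<Otimes>\<^sub>M lborel) borel (\<lambda>(x, y). Complex x y)"
proof (rule lborel_eqI)
  fix l u :: complex
  assume lu: "\<And>b. b \<in> Basis \<Longrightarrow> l \<bullet> b \<le> u \<bullet> b"
  have le: "Re l \<le> Re u" "Im l \<le> Im u"
    using lu[of 1] lu[of \<i>] by (simp_all add: Basis_complex_def inner_complex_def)
  note m = measurable_Complex_pair
  have "(\<lambda>(x, y). Complex x y) -` box l u \<inter> space (lborel \<Otimes>\<^sub>M lborel) = box (Re l) (Re u) \<times> box (Im l) (Im u)"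
    by (auto simp: box_def Basis_complex_def inner_complex_def space_pair_measure)
  then have "emeasure (distr (lborel \<Otimes>\<^sub>M lborel) borel (\<lambda>(x, y). Complex x y)) (box l u) =
      emeasure (lborel \<Otimes>\<^sub>M lborel) (box (Re l) (Re u) \<times> box (Im l) (Im u))"
    by (subst emeasure_distr[OF m]) auto
  also have "\<dots> = ennreal (Re u - Re l) * ennreal (Im u - Im l)"
    using le by (simp add: lborel.emeasure_pair_measure_Times)
  also have "\<dots> = ennreal (\<Prod>b\<in>Basis. (u - l) \<bullet> b)"
    using le by (simp add: Basis_complex_def inner_complex_def ennreal_mult complex_eq_iff)
  finally show "emeasure (distr (lborel \<Otimes>\<^sub>M lborel) borel (\<lambda>(x, y). Complex x y)) (box l u) =
      ennreal (\<Prod>b\<in>Basis. (u - l) \<bullet> b)" .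
qed simp

lemma lborel_pair_shear_fst:
  "distr (lborel \<Otimes>\<^sub>M lborel) (lborel \<Otimes>\<^sub>M lborel) (\<lambda>(x, y). (x + a * y, y)) =
     (lborel \<Otimes>\<^sub>M lborel :: (real \<times> real) measure)"
proof (rule measure_eqI)
  let ?L = "lborel \<Otimes>\<^sub>M lborel :: (real \<times> real) measure"
  let ?S = "\<lambda>(x, y). (x + a * y, y)"
  fix B assume "B \<in> sets (distr ?L ?L ?S)"
  then have B: "B \<in> sets ?L" by (simp only: sets_distr)
  have m: "?S \<in> measurable ?L ?L" by measurable
  have ind: "(indicator B :: _ \<Rightarrow> ennreal) \<in> borel_measurable ?L" by (rule borel_measurable_indicator[OF B])
  have "emeasure (distr ?L ?L ?S) B = (\<integral>\<^sup>+z. indicator B z \<partial>distr ?L ?L ?S)"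
    by (rule nn_integral_indicator[symmetric]) (simp only: sets_distr B)
  also have "\<dots> = (\<integral>\<^sup>+z. indicator B (?S z) \<partial>?L)"
    by (rule nn_integral_distr[OF m]) (simp only: measurable_distr_eq1 ind)
  also have "\<dots> = (\<integral>\<^sup>+y. \<integral>\<^sup>+x. indicator B (?S (x, y)) \<partial>lborel \<partial>lborel)"
    by (rule lborel_pair.nn_integral_snd[OF measurable_compose[OF m ind], symmetric])
  also have "\<dots> = (\<integral>\<^sup>+y. \<integral>\<^sup>+x. indicator B (x, y) \<partial>lborel \<partial>lborel)"
  proof (rule nn_integral_cong)
    fix y :: real
    have "(\<lambda>x. (x, y)) \<in> measurable borel ?L" by simp
    then have "(\<lambda>x. indicator B (x, y) :: ennreal) \<in> borel_measurable borel"
      by (rule measurable_compose[OF _ ind])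
    from nn_integral_real_affine[OF this, of 1 "a * y"]
    show "(\<integral>\<^sup>+x. indicator B (?S (x, y)) \<partial>lborel) = (\<integral>\<^sup>+x. indicator B (x, y) \<partial>lborel)"
      by (simp add: add.commute)
  qed
  also have "\<dots> = (\<integral>\<^sup>+z. indicator B z \<partial>?L)"
    by (rule lborel_pair.nn_integral_snd[OF ind])
  also have "\<dots> = emeasure ?L B" by (rule nn_integral_indicator[OF B])
  finally show "emeasure (distr ?L ?L ?S) B = emeasure ?L B" .
qed simp

lemma lborel_pair_shear_snd:
  "distr (lborel \<Otimes>\<^sub>M lborel) (lborel \<Otimes>\<^sub>M lborel) (\<lambda>(x, y). (x, y + a * x)) =
     (lborel \<Otimes>\<^sub>M lborel :: (real \<times> real) measure)"
proof -
  let ?L = "lborel \<Otimes>\<^sub>M lborel :: (real \<times> real) measure"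
  let ?S = "\<lambda>(x, y). (x + a * y, y)" and ?W = "\<lambda>(x, y). (y, x)"
  have mS: "?S \<in> measurable ?L ?L" by measurable
  have mW: "?W \<in> measurable ?L ?L" by (rule measurable_pair_swap')
  have W: "distr ?L ?L ?W = ?L" by (rule lborel_pair.distr_pair_swap[symmetric])
  have "(\<lambda>(x, y). (x, y + a * x)) = ?W \<circ> (?S \<circ> ?W)" by (auto simp: fun_eq_iff)
  then have "distr ?L ?L (\<lambda>(x, y). (x, y + a * x)) = distr ?L ?L (?W \<circ> (?S \<circ> ?W))" by (rule arg_cong)
  also have "\<dots> = distr (distr ?L ?L (?S \<circ> ?W)) ?L ?W"
    by (rule distr_distr[OF mW measurable_comp[OF mW mS], symmetric])
  also have "distr ?L ?L (?S \<circ> ?W) = distr (distr ?L ?L ?W) ?L ?S"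
    by (rule distr_distr[OF mS mW, symmetric])
  finally show ?thesis by (simp only: W lborel_pair_shear_fst)
qed

text \<open>A rotation other than the half turn is a product of three shears, with slopes \<open>a\<close>, \<open>s\<close>, \<open>a\<close> for
  \<open>a = - s / (1 + c)\<close>, and shears preserve Lebesgue measure by Fubini's theorem.\<close>

lemma lborel_complex_rotate:
  fixes c s :: real
  assumes cs: "c\<^sup>2 + s\<^sup>2 = 1" "c \<noteq> -1"
  shows "distr lborel borel (\<lambda>z. Complex c s * z) = (lborel :: complex measure)"
proof -
  let ?L = "lborel \<Otimes>\<^sub>M lborel :: (real \<times> real) measure"
  define a where "a = - s / (1 + c)"
  let ?S = "\<lambda>(x, y). (x + a * y, y)" and ?T = "\<lambda>(x, y). (x, y + s * x)" and ?C = "\<lambda>(x, y). Complex x y"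
  have mS: "?S \<in> measurable ?L ?L" and mT: "?T \<in> measurable ?L ?L" by measurable
  note mC = measurable_Complex_pair
  have c1: "1 + c \<noteq> 0" using cs(2) by linarith
  have as: "1 + a * s = c"
  proof -
    have "s * s = (1 - c) * (1 + c)" using cs(1) by (simp add: power2_eq_square algebra_simps)
    then have "a * s = - (1 - c)" unfolding a_def using c1 by (simp add: field_simps)
    then show ?thesis by simp
  qed
  have "a * (1 + c) = - s" unfolding a_def using c1 by simp
  then have ac: "a + a * c = - s" by (simp add: algebra_simps)
  have comp: "Complex c s * ?C z = ?C (?S (?T (?S z)))" for z
  proof -
    obtain x y where z: "z = (x, y)" by (cases z)
    have re: "c * x - s * y = x + a * y + a * (y + s * (x + a * y))"
    proof -
      have "x + a * y + a * (y + s * (x + a * y)) = (1 + a * s) * x + (a + a * (1 + a * s)) * y" by (simp add: algebra_simps)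
      then show ?thesis unfolding as ac by (simp add: algebra_simps)
    qed
    have "c * y + s * x = (1 + a * s) * y + s * x" unfolding as by simp
    then have im: "c * y + s * x = y + s * (x + a * y)" by (simp add: algebra_simps)
    show ?thesis using re im by (simp add: z complex_eq_iff)
  qed
  have mR: "(\<lambda>z. Complex c s * z) \<in> borel_measurable borel" by simp
  have "distr lborel borel (\<lambda>z. Complex c s * z) = distr (distr ?L borel ?C) borel (\<lambda>z. Complex c s * z)"
    unfolding lborel_complex_eq_distr_pair[symmetric] ..
  also have "\<dots> = distr ?L borel (?C \<circ> (?S \<circ> (?T \<circ> ?S)))"
    unfolding distr_distr[OF mR mC] by (rule arg_cong[of _ _ "distr ?L borel"]) (rule ext, unfold o_apply comp, rule refl)
  also have "\<dots> = distr (distr ?L ?L (?S \<circ> (?T \<circ> ?S))) borel ?C"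
    by (rule distr_distr[OF mC, symmetric]) (intro measurable_comp[OF measurable_comp[OF mS mT] mS])
  also have "distr ?L ?L (?S \<circ> (?T \<circ> ?S)) = distr (distr ?L ?L (?T \<circ> ?S)) ?L ?S"
    by (rule distr_distr[OF mS measurable_comp[OF mS mT], symmetric])
  also have "distr ?L ?L (?T \<circ> ?S) = distr (distr ?L ?L ?S) ?L ?T"
    by (rule distr_distr[OF mT mS, symmetric])
  also have "distr (distr (distr (distr ?L ?L ?S) ?L ?T) ?L ?S) borel ?C = lborel"
    unfolding lborel_pair_shear_fst lborel_pair_shear_snd by (rule lborel_complex_eq_distr_pair[symmetric])
  finally show ?thesis .
qed

lemma integral_rotation_covariant_eq_0:
  fixes f :: "complex \<Rightarrow> complex"
  assumes [measurable]: "f \<in> borel_measurable borel"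
    and \<zeta>: "cmod \<zeta> = 1" "\<zeta> \<noteq> -1" and w: "w \<noteq> 1" and f: "\<And>z. f (\<zeta> * z) = w * f z"
  shows "(\<integral>z. f z \<partial>lborel) = 0"
proof -
  have "(Re \<zeta>)\<^sup>2 + (Im \<zeta>)\<^sup>2 = 1" using \<zeta>(1) by (simp add: cmod_power2[symmetric])
  moreover have "Re \<zeta> \<noteq> -1"
  proof
    assume "Re \<zeta> = -1"
    with calculation have "Im \<zeta> = 0" by simp
    with \<open>Re \<zeta> = -1\<close> show False using \<zeta>(2) by (simp add: complex_eq_iff)
  qed
  ultimately have rot: "distr lborel borel (\<lambda>z. \<zeta> * z) = (lborel :: complex measure)"
    using lborel_complex_rotate[of "Re \<zeta>" "Im \<zeta>"] by simp
  have "(\<integral>z. f z \<partial>lborel) = (\<integral>z. f z \<partial>distr lborel borel (\<lambda>z. \<zeta> * z))" by (simp add: rot)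
  also have "\<dots> = (\<integral>z. f (\<zeta> * z) \<partial>lborel)" by (rule integral_distr) auto
  also have "\<dots> = w * (\<integral>z. f z \<partial>lborel)" by (simp add: f)
  finally have "(1 - w) * (\<integral>z. f z \<partial>lborel) = 0" by (simp add: algebra_simps)
  then show ?thesis using w by simp
qed

lemma borel_measurable_cnj: "cnj \<in> borel_measurable borel"
  by (intro borel_measurable_continuous_onI continuous_intros)

lemma integral_monomials_radial_eq_0:
  fixes g :: "real \<Rightarrow> complex"
  assumes [measurable]: "g \<in> borel_measurable borel" and "m \<noteq> n"
  shows "(\<integral>z. z ^ m * cnj z ^ n * g (cmod z) \<partial>lborel) = 0"
proof -
  note borel_measurable_cnj [measurable]
  \<comment> \<open>Rotation by this angle multiplies the integrand by the imaginary unit.\<close>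
  define \<theta> where "\<theta> = pi / (2 * (real m - real n))"
  show ?thesis
  proof (rule integral_rotation_covariant_eq_0[where \<zeta> = "cis \<theta>" and w = \<i>])
    show "(\<lambda>z. z ^ m * cnj z ^ n * g (cmod z)) \<in> borel_measurable borel" by measurable
    have "cis \<theta> ^ m * cis (- \<theta>) ^ n = cis ((real m - real n) * \<theta>)"
      unfolding Complex.DeMoivre cis_mult by (rule arg_cong[of _ _ cis]) (simp add: algebra_simps)
    also have "(real m - real n) * \<theta> = pi / 2" using assms(2) by (simp add: \<theta>_def divide_simps)
    finally have eq: "cis \<theta> ^ m * cis (- \<theta>) ^ n = \<i>" by simp
    show "(cis \<theta> * z) ^ m * cnj (cis \<theta> * z) ^ n * g (cmod (cis \<theta> * z)) =
        \<i> * (z ^ m * cnj z ^ n * g (cmod z))" for z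
    proof -
      have "(cis \<theta> * z) ^ m * cnj (cis \<theta> * z) ^ n * g (cmod (cis \<theta> * z)) =
          (cis \<theta> ^ m * cis (- \<theta>) ^ n) * (z ^ m * cnj z ^ n * g (cmod z))"
        by (simp add: norm_mult power_mult_distrib cis_cnj)
      then show ?thesis unfolding eq .
    qed
    show "cis \<theta> \<noteq> -1"
    proof
      assume "cis \<theta> = -1"
      then have "cos \<theta> = -1" by (simp add: complex_eq_iff)
      moreover have "\<bar>\<theta>\<bar> \<le> pi / 2"
      proof -
        have "1 \<le> \<bar>real m - real n\<bar>" using assms(2) by linarith
        then show ?thesis by (simp add: \<theta>_def abs_divide abs_mult field_simps)
      qed
      then have "cos \<theta> \<ge> 0" using cos_ge_zero[of \<theta>] by linarith
      ultimately show False by simp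
    qed
  qed (auto simp: complex_eq_iff)
qed

section \<open>Integration of radial functions\<close>

lemma emeasure_powr_sublevel:
  fixes p a :: real
  assumes "p > 0" "a \<ge> 0"
  shows "emeasure lborel {z :: complex. cmod z powr p \<le> a} = ennreal (pi * a powr (2 / p))"
proof -
  have "{z :: complex. cmod z powr p \<le> a} = cball 0 (a powr (1 / p))"
  proof (rule Set.set_eqI)
    fix z :: complex
    have "cmod z powr p \<le> a \<longleftrightarrow> cmod z \<le> a powr (1 / p)"
    proof
      assume "cmod z powr p \<le> a"
      then have "(cmod z powr p) powr (1 / p) \<le> a powr (1 / p)" using assms by (intro powr_mono2) auto
      then show "cmod z \<le> a powr (1 / p)" using assms by (simp add: powr_powr)
    next
      assume "cmod z \<le> a powr (1 / p)"
      then have "cmod z powr p \<le> (a powr (1 / p)) powr p" using assms by (intro powr_mono2) auto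
      then show "cmod z powr p \<le> a" using assms by (simp add: powr_powr)
    qed
    then show "z \<in> {z. cmod z powr p \<le> a} \<longleftrightarrow> z \<in> cball 0 (a powr (1 / p))" by simp
  qed
  moreover have "(a powr (1 / p))\<^sup>2 = a powr (2 / p)"
    by (simp add: powr_powr flip: powr_numeral)
  ultimately show ?thesis by (simp add: emeasure_cball unit_ball_vol_2 mult.commute)
qed

text \<open>Polar coordinates: both measures give \<open>{..a}\<close> the area of the disc of radius \<open>a powr (1 / p)\<close> if
  \<open>a \<ge> 0\<close>, and \<open>0\<close> otherwise.\<close>

lemma distr_lborel_cmod_powr:
  fixes p :: real
  assumes p: "p > 0"
  shows "distr lborel borel (\<lambda>z :: complex. cmod z powr p) =
    density lborel (\<lambda>t. ennreal (2 * pi / p * t powr (2 / p - 1)) * indicator {0..} t)"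
    (is "?D = ?N")
proof (rule measure_eqI_generator_eq)
  let ?E = "range (\<lambda>a::real. {..a})"
  show "Int_stable ?E" by (auto simp: Int_stable_def)
  show "?E \<subseteq> Pow UNIV" "sets ?D = sigma_sets UNIV ?E" "sets ?N = sigma_sets UNIV ?E"
    by (auto simp: borel_eq_atMost)
  show "range (\<lambda>n::nat. {..real n}) \<subseteq> ?E" by auto
  show "(\<Union>n::nat. {..real n}) = UNIV" by (auto intro: real_arch_simple)
  have D: "emeasure ?D {..a} = ennreal (if a \<ge> 0 then pi * a powr (2 / p) else 0)" for a
  proof -
    have "emeasure ?D {..a} = emeasure lborel {z :: complex. cmod z powr p \<le> a}"
      by (subst emeasure_distr) (auto simp: vimage_def)
    also have "\<dots> = ennreal (if a \<ge> 0 then pi * a powr (2 / p) else 0)"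
    proof (cases "a \<ge> 0")
      case False
      then have "{z :: complex. cmod z powr p \<le> a} = {}" by (auto simp: not_le intro: less_le_trans)
      then show ?thesis using False by simp
    qed (simp add: emeasure_powr_sublevel p)
    finally show ?thesis .
  qed
  show "emeasure ?D {..real n} \<noteq> \<infinity>" for n unfolding D by simp
  fix X assume "X \<in> ?E"
  then obtain a where X: "X = {..a}" by auto
  have "emeasure ?N {..a} = (\<integral>\<^sup>+t. ennreal (2 * pi / p * t powr (2 / p - 1)) * indicator {0..} t * indicator {..a} t \<partial>lborel)"
    by (rule emeasure_density) auto
  also have "\<dots> = (\<integral>\<^sup>+t. ennreal (2 * pi / p * t powr (2 / p - 1)) * indicator {0..a} t \<partial>lborel)"
    by (intro nn_integral_cong) (auto simp: indicator_def)
  also have "\<dots> = ennreal (if a \<ge> 0 then pi * a powr (2 / p) else 0)"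
  proof (cases "a \<ge> 0")
    case True
    have "((\<lambda>t. 2 * pi / p * t powr (2 / p - 1)) has_integral
        (2 * pi / p * (a powr (2 / p - 1 + 1) / (2 / p - 1 + 1)))) {0..a}"
      using p True by (intro has_integral_mult_right has_integral_powr_from_0) auto
    also have "2 * pi / p * (a powr (2 / p - 1 + 1) / (2 / p - 1 + 1)) = pi * a powr (2 / p)"
      using p by (simp add: field_simps)
    finally have "(\<integral>\<^sup>+t. ennreal (2 * pi / p * t powr (2 / p - 1)) * indicator {0..a} t \<partial>lborel) =
        ennreal (pi * a powr (2 / p))"
      using p by (intro nn_integral_has_integral_lebesgue') auto
    then show ?thesis using True by simp
  qed simp
  finally show "emeasure ?D X = emeasure ?N X" unfolding X D ..
qed

lemma nn_integral_radial:
  fixes p :: real and g :: "real \<Rightarrow> ennreal"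
  assumes "p > 0" and g: "g \<in> borel_measurable borel"
  shows "(\<integral>\<^sup>+z. g (cmod z powr p) \<partial>(lborel :: complex measure)) =
    (\<integral>\<^sup>+t. ennreal (2 * pi / p * t powr (2 / p - 1)) * indicator {0..} t * g t \<partial>lborel)"
proof -
  have "(\<integral>\<^sup>+z. g (cmod z powr p) \<partial>(lborel :: complex measure)) =
      (\<integral>\<^sup>+t. g t \<partial>distr lborel borel (\<lambda>z :: complex. cmod z powr p))"
    by (subst nn_integral_distr) (use g in auto)
  also have "\<dots> = (\<integral>\<^sup>+t. ennreal (2 * pi / p * t powr (2 / p - 1)) * indicator {0..} t * g t \<partial>lborel)"
    unfolding distr_lborel_cmod_powr[OF assms(1)] by (rule nn_integral_density) (use g in auto)
  finally show ?thesis .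
qed

section \<open>Integrals of determinants of biorthogonal kernels\<close>

text \<open>The signs of the permutations that leave \<open>f\<close> unchanged cancel unless \<open>f\<close> is injective.\<close>

lemma sum_sign_stabilizer:
  fixes f :: "nat \<Rightarrow> 'a"
  shows "(\<Sum>p | p permutes {0..<k} \<and> (\<forall>i<k. f (p i) = f i). of_int (sign p) :: complex) =
    (if inj_on f {..<k} then 1 else 0)"
proof (cases "inj_on f {..<k}")
  case True
  have "{p. p permutes {0..<k} \<and> (\<forall>i<k. f (p i) = f i)} = {id}"
  proof (intro equalityI subsetI)
    fix p assume p: "p \<in> {p. p permutes {0..<k} \<and> (\<forall>i<k. f (p i) = f i)}"
    have "p i = i" for i
    proof (cases "i < k")
      case i: True
      then have "p i < k" using p permutes_in_image[of p "{0..<k}" i] by auto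
      then show ?thesis using p i True by (auto dest: inj_onD)
    next
      case False
      then show ?thesis using p by (auto simp: permutes_def)
    qed
    then show "p \<in> {id}" by auto
  qed (auto simp: permutes_id)
  then show ?thesis using True by simp
next
  case False
  then obtain a b where ab: "a < k" "b < k" "a \<noteq> b" "f a = f b" by (auto simp: inj_on_def)
  let ?T = "{p. p permutes {0..<k} \<and> (\<forall>i<k. f (p i) = f i)}"
  \<comment> \<open>Composition with this transposition is a sign-reversing involution of the stabilizer.\<close>
  let ?t = "Transposition.transpose a b"
  have t: "?t permutes {0..<k}" using ab by (intro permutes_swap_id) auto
  have ft: "f (?t i) = f i" for i using ab by (simp add: Transposition.transpose_def)
  have in_T: "?t \<circ> p \<in> ?T" if "p \<in> ?T" for p
    using that permutes_compose[OF _ t, of p] by (simp add: ft)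
  have sg: "sign (?t \<circ> p) = - sign p" if "p \<in> ?T" for p
  proof -
    have "permutation p" "permutation ?t"
      using that t permutation_permutes by (auto intro: permutes_imp_permutation[of "{0..<k}"])
    then show ?thesis using ab by (simp add: sign_compose sign_swap_id)
  qed
  have "(\<Sum>p\<in>?T. of_int (sign p) :: complex) = (\<Sum>p\<in>?T. of_int (sign (?t \<circ> p)))"
  proof (rule sum.reindex_bij_witness[of _ "\<lambda>p. ?t \<circ> p" "\<lambda>p. ?t \<circ> p"])
    fix p :: "nat \<Rightarrow> nat"
    have tt: "?t \<circ> (?t \<circ> p) = p" by (simp add: fun_eq_iff)
    then show "?t \<circ> (?t \<circ> p) = p" "?t \<circ> (?t \<circ> p) = p" by (simp_all only:)
    show "of_int (sign (?t \<circ> (?t \<circ> p))) = (of_int (sign p) :: complex)" by (simp only: tt)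
  qed (erule in_T)+
  also have "\<dots> = - (\<Sum>p\<in>?T. of_int (sign p))"
    unfolding sum_negf[symmetric] by (intro sum.cong refl) (simp only: sg of_int_minus)
  finally show ?thesis using False by simp
qed

lemma det_mat_leibniz:
  fixes B :: "nat \<Rightarrow> nat \<Rightarrow> complex"
  shows "Determinant.det (Matrix.mat k k (\<lambda>(i, j). B i j)) =
    (\<Sum>p | p permutes {0..<k}. of_int (sign p) * (\<Prod>i<k. B i (p i)))"
proof -
  let ?A = "Matrix.mat k k (\<lambda>(i, j). B i j)"
  have "Determinant.det ?A = (\<Sum>p | p permutes {0..<k}. of_int (sign p) * (\<Prod>i = 0..<k. ?A $$ (i, p i)))"
    by (rule det_def') simp
  also have "\<dots> = (\<Sum>p | p permutes {0..<k}. of_int (sign p) * (\<Prod>i<k. B i (p i)))"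
  proof (intro sum.cong refl arg_cong2[of _ _ _ _ "(*)"] prod.cong)
    fix p i assume "p \<in> {p. p permutes {0..<k}}" "i \<in> {..<k}"
    then have "i < k" "p i < k" using permutes_in_image[of p "{0..<k}" i] by auto
    then show "?A $$ (i, p i) = B i (p i)" by simp
  qed auto
  finally show ?thesis .
qed

lemma det_sum_products:
  fixes P Q :: "nat \<Rightarrow> 'a \<Rightarrow> complex"
  shows "Determinant.det (Matrix.mat k k (\<lambda>(i, l). \<Sum>j<n. P j (x i) * Q j (x l))) =
    (\<Sum>p | p permutes {0..<k}. of_int (sign p) *
      (\<Sum>f\<in>{..<k} \<rightarrow>\<^sub>E {..<n}. \<Prod>i<k. P (f i) (x i) * Q (f (inv_into UNIV p i)) (x i)))"
proof -
  have "Determinant.det (Matrix.mat k k (\<lambda>(i, l). \<Sum>j<n. P j (x i) * Q j (x l))) =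
    (\<Sum>p | p permutes {0..<k}. of_int (sign p) * (\<Prod>i<k. \<Sum>j<n. P j (x i) * Q j (x (p i))))"
    by (rule det_mat_leibniz)
  also have "\<dots> = (\<Sum>p | p permutes {0..<k}. of_int (sign p) *
      (\<Sum>f\<in>{..<k} \<rightarrow>\<^sub>E {..<n}. \<Prod>i<k. P (f i) (x i) * Q (f (inv_into UNIV p i)) (x i)))"
  proof (intro sum.cong refl arg_cong2[of _ _ _ _ "(*)"])
    fix p assume "p \<in> {p. p permutes {0..<k}}"
    then have p: "p permutes {..<k}" by (simp add: lessThan_atLeast0)
    have "(\<Prod>i<k. \<Sum>j<n. P j (x i) * Q j (x (p i))) =
        (\<Sum>f\<in>{..<k} \<rightarrow>\<^sub>E {..<n}. \<Prod>i<k. P (f i) (x i) * Q (f i) (x (p i)))"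
      by (rule prod_sum_PiE) auto
    also have "\<dots> = (\<Sum>f\<in>{..<k} \<rightarrow>\<^sub>E {..<n}. \<Prod>i<k. P (f i) (x i) * Q (f (inv_into UNIV p i)) (x i))"
    proof (rule sum.cong[OF refl])
      fix f
      have "(\<Prod>i<k. Q (f (inv_into UNIV p i)) (x i)) = (\<Prod>i<k. Q (f i) (x (p i)))"
        by (subst prod.permute[OF p]) (simp add: o_def permutes_inverses[OF p])
      then show "(\<Prod>i<k. P (f i) (x i) * Q (f i) (x (p i))) = (\<Prod>i<k. P (f i) (x i) * Q (f (inv_into UNIV p i)) (x i))"
        by (simp add: prod.distrib)
    qed
    finally show "(\<Prod>i<k. \<Sum>j<n. P j (x i) * Q j (x (p i))) =
        (\<Sum>f\<in>{..<k} \<rightarrow>\<^sub>E {..<n}. \<Prod>i<k. P (f i) (x i) * Q (f (inv_into UNIV p i)) (x i))" .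
  qed
  finally show ?thesis .
qed

text \<open>After expansion of the determinant and of the kernel, biorthogonality keeps exactly the pairs of a
  permutation \<open>p\<close> and an index map \<open>f\<close> with \<open>f \<circ> p = f\<close>; the sum over \<open>p\<close> then removes the non-injective \<open>f\<close>.\<close>

lemma integral_det_biorthogonal:
  fixes P Q :: "nat \<Rightarrow> complex \<Rightarrow> complex" and lam :: "nat \<Rightarrow> real"
  assumes int: "\<And>i j. integrable lborel (\<lambda>z. P i z * Q j z)"
    and orth: "\<And>i j. (\<integral>z. P i z * Q j z \<partial>lborel) = (if i = j then complex_of_real (lam j) else 0)"
  shows "integrable (Pi\<^sub>M {..<k} (\<lambda>_. lborel))
      (\<lambda>x. Determinant.det (Matrix.mat k k (\<lambda>(i, l). \<Sum>j<n. P j (x i) * Q j (x l))))" (is ?int)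
    and "(\<integral>x. Determinant.det (Matrix.mat k k (\<lambda>(i, l). \<Sum>j<n. P j (x i) * Q j (x l))) \<partial>Pi\<^sub>M {..<k} (\<lambda>_. lborel)) =
      complex_of_real (\<Sum>f\<in>inj_maps k {..<n}. \<Prod>i<k. lam (f i))"
proof -
  interpret product_sigma_finite "\<lambda>_ :: nat. lborel :: complex measure" by standard
  let ?F = "\<lambda>p f x. \<Prod>i<k. P (f i) (x i) * Q (f (inv_into UNIV p i)) (x i)"
  have i1: "integrable (Pi\<^sub>M {..<k} (\<lambda>_. lborel)) (?F p f)" for p f :: "nat \<Rightarrow> nat"
    by (rule product_integrable_prod) (auto intro: int)
  show ?int unfolding det_sum_products
    by (intro Bochner_Integration.integrable_sum integrable_mult_right i1)
  have i2: "(\<integral>x. ?F p f x \<partial>Pi\<^sub>M {..<k} (\<lambda>_. lborel)) =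
      (if \<forall>i<k. f (p i) = f i then \<Prod>i<k. complex_of_real (lam (f i)) else 0)"
    if p: "p permutes {0..<k}" for p f :: "nat \<Rightarrow> nat"
  proof -
    have "(\<integral>x. ?F p f x \<partial>Pi\<^sub>M {..<k} (\<lambda>_. lborel)) = (\<Prod>i<k. \<integral>z. P (f i) z * Q (f (inv_into UNIV p i)) z \<partial>lborel)"
      by (rule product_integral_prod) (auto intro: int)
    also have "\<dots> = (\<Prod>i<k. if f i = f (inv_into UNIV p i) then complex_of_real (lam (f i)) else 0)"
      by (intro prod.cong refl) (simp add: orth)
    also have "\<dots> = (if \<forall>i<k. f i = f (inv_into UNIV p i) then \<Prod>i<k. complex_of_real (lam (f i)) else 0)"
    proof (cases "\<forall>i<k. f i = f (inv_into UNIV p i)")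
      case False
      then obtain i where "i < k" "f i \<noteq> f (inv_into UNIV p i)" by blast
      then show ?thesis using False by (subst prod_zero) auto
    qed simp
    also have "(\<forall>i<k. f i = f (inv_into UNIV p i)) \<longleftrightarrow> (\<forall>i<k. f (p i) = f i)"
    proof
      assume *: "\<forall>i<k. f i = f (inv_into UNIV p i)"
      show "\<forall>i<k. f (p i) = f i"
      proof (intro allI impI)
        fix i assume "i < k"
        then have "p i < k" using permutes_in_image[OF p, of i] by simp
        then show "f (p i) = f i" using * permutes_inverses(2)[OF p, of i] by simp
      qed
    next
      assume *: "\<forall>i<k. f (p i) = f i"
      show "\<forall>i<k. f i = f (inv_into UNIV p i)"
      proof (intro allI impI)
        fix i assume "i < k"
        then have "inv_into UNIV p i < k" using permutes_in_image[OF permutes_inv[OF p], of i] by simp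
        then show "f i = f (inv_into UNIV p i)" using * permutes_inverses(1)[OF p, of i] by auto
      qed
    qed
    finally show ?thesis .
  qed
  have fin: "finite {p. p permutes {0..<k}}" by (rule finite_permutations) simp
  have "(\<integral>x. Determinant.det (Matrix.mat k k (\<lambda>(i, l). \<Sum>j<n. P j (x i) * Q j (x l))) \<partial>Pi\<^sub>M {..<k} (\<lambda>_. lborel)) =
     (\<Sum>p | p permutes {0..<k}. of_int (sign p) *
       (\<Sum>f\<in>{..<k} \<rightarrow>\<^sub>E {..<n}. if \<forall>i<k. f (p i) = f i then \<Prod>i<k. complex_of_real (lam (f i)) else 0))"
    unfolding det_sum_products
    by (simp add: Bochner_Integration.integral_sum Bochner_Integration.integrable_sum i1 i2)
  also have "\<dots> = (\<Sum>f\<in>{..<k} \<rightarrow>\<^sub>E {..<n}. \<Sum>p | p permutes {0..<k}.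
       of_int (sign p) * (if \<forall>i<k. f (p i) = f i then \<Prod>i<k. complex_of_real (lam (f i)) else 0))"
    unfolding sum_distrib_left by (rule sum.swap)
  also have "\<dots> = (\<Sum>f\<in>{..<k} \<rightarrow>\<^sub>E {..<n}.
       (if inj_on f {..<k} then 1 else 0) * (\<Prod>i<k. complex_of_real (lam (f i))))"
  proof (rule sum.cong[OF refl])
    fix f :: "nat \<Rightarrow> nat"
    have "(\<Sum>p | p permutes {0..<k}. of_int (sign p) *
          (if \<forall>i<k. f (p i) = f i then \<Prod>i<k. complex_of_real (lam (f i)) else 0)) =
        (\<Sum>p | p permutes {0..<k}. if \<forall>i<k. f (p i) = f i
          then of_int (sign p) * (\<Prod>i<k. complex_of_real (lam (f i))) else 0)"
      by (intro sum.cong) auto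
    also have "\<dots> = (\<Sum>p | p permutes {0..<k} \<and> (\<forall>i<k. f (p i) = f i).
        of_int (sign p) * (\<Prod>i<k. complex_of_real (lam (f i))))"
      by (subst sum.inter_filter[OF fin, symmetric]) simp
    also have "\<dots> = (\<Sum>p | p permutes {0..<k} \<and> (\<forall>i<k. f (p i) = f i). of_int (sign p)) *
        (\<Prod>i<k. complex_of_real (lam (f i)))"
      by (rule sum_distrib_right[symmetric])
    finally show "(\<Sum>p | p permutes {0..<k}. of_int (sign p) *
          (if \<forall>i<k. f (p i) = f i then \<Prod>i<k. complex_of_real (lam (f i)) else 0)) =
        (if inj_on f {..<k} then 1 else 0) * (\<Prod>i<k. complex_of_real (lam (f i)))"
      unfolding sum_sign_stabilizer .
  qed
  also have "\<dots> = (\<Sum>f\<in>inj_maps k {..<n}. \<Prod>i<k. complex_of_real (lam (f i)))"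
    unfolding inj_maps_def sum.inter_filter[OF finite_PiE[OF finite_lessThan finite_lessThan]]
    by (rule sum.cong) simp_all
  finally show "(\<integral>x. Determinant.det (Matrix.mat k k (\<lambda>(i, l). \<Sum>j<n. P j (x i) * Q j (x l))) \<partial>Pi\<^sub>M {..<k} (\<lambda>_. lborel)) =
      complex_of_real (\<Sum>f\<in>inj_maps k {..<n}. \<Prod>i<k. lam (f i))" by simp
qed

section \<open>Void probabilities of determinantal processes\<close>

lemma norm_det_le:
  fixes B :: "nat \<Rightarrow> nat \<Rightarrow> complex"
  assumes "\<And>i j. i < k \<Longrightarrow> j < k \<Longrightarrow> norm (B i j) \<le> b"
  shows "norm (Determinant.det (Matrix.mat k k (\<lambda>(i, j). B i j))) \<le> fact k * b ^ k"
proof -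
  have "norm (\<Sum>p | p permutes {0..<k}. of_int (sign p) * (\<Prod>i<k. B i (p i))) \<le> (\<Sum>p | p permutes {0..<k}. b ^ k)"
  proof (rule sum_norm_le)
    fix p assume p: "p \<in> {p. p permutes {0..<k}}"
    have "norm (of_int (sign p) * (\<Prod>i<k. B i (p i))) = (\<Prod>i<k. norm (B i (p i)))"
      by (simp add: norm_mult prod_norm sign_def)
    also have "\<dots> \<le> (\<Prod>i<k. b)"
    proof (rule prod_mono)
      fix i assume "i \<in> {..<k}"
      then have "i < k" "p i < k" using p permutes_in_image[of p "{0..<k}" i] by auto
      then show "0 \<le> norm (B i (p i)) \<and> norm (B i (p i)) \<le> b" using assms by simp
    qed
    finally show "norm (of_int (sign p) * (\<Prod>i<k. B i (p i))) \<le> b ^ k" by simp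
  qed
  also have "\<dots> = fact k * b ^ k" by (simp add: card_permutations)
  finally show ?thesis unfolding det_mat_leibniz .
qed

lemma tendsto_det:
  fixes B :: "nat \<Rightarrow> nat \<Rightarrow> nat \<Rightarrow> complex"
  assumes "\<And>i j. i < k \<Longrightarrow> j < k \<Longrightarrow> (\<lambda>n. B n i j) \<longlonglongrightarrow> C i j"
  shows "(\<lambda>n. Determinant.det (Matrix.mat k k (\<lambda>(i, j). B n i j))) \<longlonglongrightarrow>
    Determinant.det (Matrix.mat k k (\<lambda>(i, j). C i j))"
  unfolding det_mat_leibniz
proof (intro tendsto_sum tendsto_mult tendsto_const tendsto_prod)
  fix p i assume "p \<in> {p. p permutes {0..<k}}" "i \<in> {..<k}"
  then have "i < k" "p i < k" using permutes_in_image[of p "{0..<k}" i] by auto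
  then show "(\<lambda>n. B n i (p i)) \<longlonglongrightarrow> C i (p i)" by (rule assms)
qed

lemma det_row_eq_0:
  fixes B :: "nat \<Rightarrow> nat \<Rightarrow> complex"
  assumes "i < k" "\<And>j. j < k \<Longrightarrow> B i j = 0"
  shows "Determinant.det (Matrix.mat k k (\<lambda>(i, j). B i j)) = 0"
  unfolding det_mat_leibniz
proof (rule sum.neutral, rule ballI)
  fix p assume p: "p \<in> {p. p permutes {0..<k}}"
  have "p i < k" using assms(1) p permutes_in_image[of p "{0..<k}" i] by auto
  then have "(\<Prod>i<k. B i (p i)) = 0"
    using assms by (intro prod_zero[OF finite_lessThan] bexI[of _ i]) auto
  then show "of_int (sign p) * (\<Prod>i<k. B i (p i)) = 0" by simp
qed

text \<open>The kernel is only assumed to have a biorthogonal expansion on \<open>A\<close>, with \<open>lam j\<close> the integral of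
  \<open>P j * Q j\<close> over \<open>A\<close>. The void probability is the Fredholm determinant \<open>\<Prod>\<^sub>j (1 - lam j)\<close>.\<close>

context
  fixes M :: "'w measure" and X :: "'w \<Rightarrow> complex set" and K :: "complex \<Rightarrow> complex \<Rightarrow> complex"
    and A :: "complex set" and P Q :: "nat \<Rightarrow> complex \<Rightarrow> complex"
    and b lam :: "nat \<Rightarrow> real"
  assumes A: "A \<in> sets borel" "bounded A"
    and meas: "\<And>j. P j \<in> borel_measurable borel" "\<And>j. Q j \<in> borel_measurable borel"
    and bound: "\<And>i j z w. z \<in> A \<Longrightarrow> w \<in> A \<Longrightarrow> norm (P j z * Q j w) \<le> b j" "summable b"
    and int: "\<And>i j. integrable lborel (\<lambda>z. indicator A z * P i z * Q j z)"
    and orth: "\<And>i j. (\<integral>z. indicator A z * P i z * Q j z \<partial>lborel) = (if i = j then complex_of_real (lam j) else 0)"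
    and lam: "\<And>j. 0 \<le> lam j" "summable lam"
    and K: "\<And>z w. z \<in> A \<Longrightarrow> w \<in> A \<Longrightarrow> (\<lambda>j. P j z * Q j w) sums K z w"
begin

text \<open>The determinant of the kernel truncated to \<open>n\<close> terms. The indicator in each row makes it vanish
  unless all points lie in \<open>A\<close>.\<close>

definition truncated_det :: "nat \<Rightarrow> nat \<Rightarrow> (nat \<Rightarrow> complex) \<Rightarrow> complex" where
  "truncated_det k n x =
    Determinant.det (Matrix.mat k k (\<lambda>(i, l). \<Sum>j<n. (indicator A (x i) * P j (x i)) * Q j (x l)))"

lemma truncated_det_bound:
  assumes "x \<in> space (Pi\<^sub>M {..<k} (\<lambda>_. lborel :: complex measure))"
  shows "norm (truncated_det k n x) \<le> fact k * (\<Sum>j. b j) ^ k * indicator (Pi\<^sub>E {..<k} (\<lambda>_. A)) x"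
proof (cases "x \<in> Pi\<^sub>E {..<k} (\<lambda>_. A)")
  case True
  have "norm (truncated_det k n x) \<le> fact k * (\<Sum>j. b j) ^ k"
    unfolding truncated_det_def
  proof (rule norm_det_le)
    fix i l assume il: "i < k" "l < k"
    then have x: "x i \<in> A" "x l \<in> A" using True by auto
    have "norm (\<Sum>j<n. (indicator A (x i) * P j (x i)) * Q j (x l)) \<le> (\<Sum>j<n. b j)"
      by (rule sum_norm_le) (use x bound(1) in simp)
    also have "\<dots> \<le> (\<Sum>j. b j)"
      by (rule sum_le_suminf[OF bound(2)]) (use norm_ge_zero order_trans bound(1)[OF x] in blast)+
    finally show "norm (\<Sum>j<n. (indicator A (x i) * P j (x i)) * Q j (x l)) \<le> (\<Sum>j. b j)" .
  qed
  then show ?thesis using True by simp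
next
  case False
  then obtain i where i: "i < k" "x i \<notin> A" using assms by (auto simp: space_PiM PiE_def)
  then have "truncated_det k n x = 0" unfolding truncated_det_def by (intro det_row_eq_0[of i]) auto
  then show ?thesis using False by simp
qed

lemma truncated_det_tendsto:
  assumes "x \<in> space (Pi\<^sub>M {..<k} (\<lambda>_. lborel :: complex measure))"
  shows "(\<lambda>n. truncated_det k n x) \<longlonglongrightarrow>
    Determinant.det (Matrix.mat k k (\<lambda>(i, j). K (x i) (x j))) * indicator (Pi\<^sub>E {..<k} (\<lambda>_. A)) x"
proof (cases "x \<in> Pi\<^sub>E {..<k} (\<lambda>_. A)")
  case True
  have "(\<lambda>n. truncated_det k n x) \<longlonglongrightarrow> Determinant.det (Matrix.mat k k (\<lambda>(i, j). K (x i) (x j)))"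
    unfolding truncated_det_def
  proof (rule tendsto_det)
    fix i l assume "i < k" "l < k"
    then have x: "x i \<in> A" "x l \<in> A" using True by auto
    then show "(\<lambda>n. \<Sum>j<n. (indicator A (x i) * P j (x i)) * Q j (x l)) \<longlonglongrightarrow> K (x i) (x l)"
      using K[OF x] by (simp add: sums_def)
  qed
  then show ?thesis using True by simp
next
  case False
  then obtain i where i: "i < k" "x i \<notin> A" using assms by (auto simp: space_PiM PiE_def)
  then have "truncated_det k n x = 0" for n unfolding truncated_det_def by (intro det_row_eq_0[of i]) auto
  then show ?thesis using False by simp
qed

lemma integral_truncated_det:
  "integrable (Pi\<^sub>M {..<k} (\<lambda>_. lborel)) (truncated_det k n)"
  "(\<integral>x. truncated_det k n x \<partial>Pi\<^sub>M {..<k} (\<lambda>_. lborel)) =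
    complex_of_real (\<Sum>f\<in>inj_maps k {..<n}. \<Prod>i<k. lam (f i))"
  unfolding truncated_det_def
  by (rule integral_det_biorthogonal; fact int orth)+

lemma integrable_dominating:
  "integrable (Pi\<^sub>M {..<k} (\<lambda>_. lborel)) (\<lambda>x. fact k * (\<Sum>j. b j) ^ k * indicator (Pi\<^sub>E {..<k} (\<lambda>_. A)) x :: real)"
proof -
  interpret product_sigma_finite "\<lambda>_ :: nat. lborel :: complex measure" by standard
  have "emeasure (Pi\<^sub>M {..<k} (\<lambda>_. lborel)) (Pi\<^sub>E {..<k} (\<lambda>_. A)) = (\<Prod>i<k. emeasure lborel A)"
    by (rule emeasure_PiM) (use A in auto)
  also have "\<dots> < \<infinity>" using emeasure_bounded_finite[OF A(2)] by (simp add: power_less_top_ennreal)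
  finally have "emeasure (Pi\<^sub>M {..<k} (\<lambda>_. lborel)) (Pi\<^sub>E {..<k} (\<lambda>_. A)) < \<infinity>" .
  moreover have "Pi\<^sub>E {..<k} (\<lambda>_. A) \<in> sets (Pi\<^sub>M {..<k} (\<lambda>_. lborel))"
    by (rule sets_PiM_I_finite) (use A in auto)
  ultimately show ?thesis by (intro integrable_mult_right integrable_real_indicator)
qed

text \<open>\<open>k!\<close> times the \<open>k\<close>-th elementary symmetric function of the first \<open>n\<close> numbers \<open>lam j\<close>.\<close>

definition symmetric_sum :: "nat \<Rightarrow> nat \<Rightarrow> real" where
  "symmetric_sum k n = (\<Sum>f\<in>inj_maps k {..<n}. \<Prod>i<k. lam (f i))"

lemma symmetric_sum_bounds: "0 \<le> symmetric_sum k n" "symmetric_sum k n \<le> (\<Sum>j. lam j) ^ k"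
proof -
  show "0 \<le> symmetric_sum k n" unfolding symmetric_sum_def by (intro sum_nonneg prod_nonneg ballI lam)
  have "symmetric_sum k n \<le> (\<Sum>f\<in>{..<k} \<rightarrow>\<^sub>E {..<n}. \<Prod>i<k. lam (f i))"
    unfolding symmetric_sum_def
    by (rule sum_mono2) (auto simp: inj_maps_def finite_PiE intro!: prod_nonneg lam)
  also have "\<dots> = (\<Prod>i<k. \<Sum>j<n. lam j)"
    by (rule prod_sum_PiE[symmetric]) auto
  also have "\<dots> \<le> (\<Sum>j. lam j) ^ k"
    by (simp, intro power_mono sum_le_suminf lam sum_nonneg) auto
  finally show "symmetric_sum k n \<le> (\<Sum>j. lam j) ^ k" .
qed

theorem determinantal_void_probability:
  assumes det: "determinantal_process M X K"
  shows "(\<lambda>n. \<Prod>j<n. 1 - lam j) \<longlonglongrightarrow> measure M {\<omega> \<in> space M. num_points X A \<omega> = 0}"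
proof -
  obtain \<rho> where spp: "simple_point_process M X" and ji: "joint_intensities M X \<rho>"
    and \<rho>: "\<And>k x. k \<ge> 1 \<Longrightarrow> complex_of_real (\<rho> k x) = Determinant.det (Matrix.mat k k (\<lambda>(i, j). K (x i) (x j)))"
    using det unfolding determinantal_process_def by blast
  let ?S = "\<lambda>k. Pi\<^sub>M {..<k} (\<lambda>_. lborel :: complex measure)"
  let ?AA = "\<lambda>k. Pi\<^sub>E {..<k} (\<lambda>_::nat. A)"
  have \<rho>m: "\<rho> k \<in> borel_measurable (?S k)" and \<rho>nn: "\<And>x. 0 \<le> \<rho> k x" if "k \<ge> 1" for k
    using ji that by (auto simp: joint_intensities_def)
  have AA: "?AA k \<in> sets (?S k)" for k by (rule sets_PiM_I_finite) (use A in auto)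
  define J where "J k = (if k = 0 then 1 else \<integral>x. \<rho> k x * indicator (?AA k) x \<partial>?S k)" for k
  have lim: "(\<lambda>n. symmetric_sum k n) \<longlonglongrightarrow> J k" and
       J: "k \<ge> 1 \<Longrightarrow> (\<integral>\<^sup>+x\<in>?AA k. ennreal (\<rho> k x) \<partial>?S k) = ennreal (J k)" for k
  proof -
    have "(\<lambda>n. symmetric_sum k n) \<longlonglongrightarrow> J k \<and>
       (k \<ge> 1 \<longrightarrow> (\<integral>\<^sup>+x\<in>?AA k. ennreal (\<rho> k x) \<partial>?S k) = ennreal (J k))"
    proof (cases "k = 0")
      case True
      have "symmetric_sum 0 n = 1" for n by (simp add: symmetric_sum_def inj_maps_def)
      then show ?thesis using True by (simp add: J_def)
    next
      case False
      then have k: "k \<ge> 1" by simp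
      let ?g = "\<lambda>x. \<rho> k x * indicator (?AA k) x"
      have gm: "(\<lambda>x. complex_of_real (?g x)) \<in> borel_measurable (?S k)"
        using \<rho>m[OF k] AA[of k] by measurable
      have td: "(\<lambda>n. truncated_det k n x) \<longlonglongrightarrow> complex_of_real (?g x)" if "x \<in> space (?S k)" for x
        using truncated_det_tendsto[OF that] \<rho>[OF k, of x] by (simp add: of_real_indicator)
      have dc: "integrable (?S k) (\<lambda>x. complex_of_real (?g x))"
        "(\<lambda>n. \<integral>x. truncated_det k n x \<partial>?S k) \<longlonglongrightarrow> (\<integral>x. complex_of_real (?g x) \<partial>?S k)"
      proof -
        note * = gm borel_measurable_integrable[OF integral_truncated_det(1), of k] integrable_dominating[of k]
          AE_I2[OF td] AE_I2[OF truncated_det_bound, where M = "?S k"]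
        show "integrable (?S k) (\<lambda>x. complex_of_real (?g x))"
          by (rule integrable_dominated_convergence[where s = "\<lambda>n x. truncated_det k n x"]) (rule * | assumption)+
        show "(\<lambda>n. \<integral>x. truncated_det k n x \<partial>?S k) \<longlonglongrightarrow> (\<integral>x. complex_of_real (?g x) \<partial>?S k)"
          by (rule integral_dominated_convergence[where s = "\<lambda>n x. truncated_det k n x"]) (rule * | assumption)+
      qed
      have gi: "integrable (?S k) ?g" using dc(1) by (simp only: complex_of_real_integrable_eq)
      have "(\<lambda>n. complex_of_real (symmetric_sum k n)) \<longlonglongrightarrow> complex_of_real (J k)"
        using dc(2) False unfolding integral_truncated_det(2) integral_complex_of_real
        by (simp only: symmetric_sum_def J_def if_False)
      then have "(\<lambda>n. symmetric_sum k n) \<longlonglongrightarrow> J k" by (simp only: tendsto_of_real_iff)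
      moreover have "(\<integral>\<^sup>+x\<in>?AA k. ennreal (\<rho> k x) \<partial>?S k) = (\<integral>\<^sup>+x. ennreal (?g x) \<partial>?S k)"
        by (intro nn_integral_cong) (simp add: indicator_def)
      moreover have "\<dots> = ennreal (\<integral>x. ?g x \<partial>?S k)"
        by (rule nn_integral_eq_integral[OF gi]) (simp add: \<rho>nn[OF k])
      ultimately show ?thesis using False by (simp add: J_def)
    qed
    then show "(\<lambda>n. symmetric_sum k n) \<longlonglongrightarrow> J k"
      "k \<ge> 1 \<Longrightarrow> (\<integral>\<^sup>+x\<in>?AA k. ennreal (\<rho> k x) \<partial>?S k) = ennreal (J k)" by auto
  qed
  have Jnn: "0 \<le> J k" for k
    by (rule LIMSEQ_le_const[OF lim[of k]]) (simp add: symmetric_sum_bounds)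
  have Jle: "J k \<le> (\<Sum>j. lam j) ^ k" for k
    by (rule LIMSEQ_le_const2[OF lim[of k]]) (simp add: symmetric_sum_bounds)
  have se: "summable (\<lambda>k. (\<Sum>j. lam j) ^ k / fact k)"
    using summable_exp[of "\<Sum>j. lam j"] by (simp add: divide_inverse mult.commute)
  have sJ: "summable (\<lambda>k. J k / fact k)"
    by (rule summable_comparison_test'[OF se, of 0]) (simp add: Jnn Jle divide_right_mono)
  have void: "measure M {\<omega> \<in> space M. num_points X A \<omega> = 0} = (\<Sum>k. (- 1) ^ k / fact k * J k)"
    by (rule void_probability[OF spp ji A _ Jnn J sJ]) (simp_all add: J_def)
  have "(\<lambda>n. \<Sum>k. (- 1) ^ k / fact k * symmetric_sum k n) \<longlonglongrightarrow> (\<Sum>k. (- 1) ^ k / fact k * J k)"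
  proof (rule tannerys_theorem[THEN conjunct2, THEN conjunct2])
    show "(\<lambda>n. (- 1) ^ k / fact k * symmetric_sum k n) \<longlonglongrightarrow> (- 1) ^ k / fact k * J k" for k
      by (intro tendsto_intros lim)
    show "\<forall>\<^sub>F (k, n) in at_top \<times>\<^sub>F sequentially.
        norm ((- 1) ^ k / fact k * symmetric_sum k n) \<le> (\<Sum>j. lam j) ^ k / fact k"
      using symmetric_sum_bounds by (intro always_eventually) (auto simp: abs_mult divide_right_mono)
  qed (use se in auto)
  moreover have "(\<Sum>k. (- 1) ^ k / fact k * symmetric_sum k n) = (\<Prod>j<n. 1 - lam j)" for n
    using sums_unique[OF prod_one_plus_inj_maps_sums[of "{..<n}" "- 1" lam]]
    by (simp add: symmetric_sum_def)
  ultimately show ?thesis unfolding void by simp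
qed

end

section \<open>Tails of the gamma distribution\<close>

text \<open>The gamma distribution with shape \<open>s\<close> and rate \<open>1\<close>.\<close>

definition gamma_law :: "real \<Rightarrow> real measure" where
  "gamma_law s = density lborel (\<lambda>t. ennreal (indicator {0..} t * t powr (s - 1) / exp t / Gamma s))"

lemma sets_gamma_law [simp]: "sets (gamma_law s) = sets borel"
  by (simp add: gamma_law_def)

lemma space_gamma_law [simp]: "space (gamma_law s) = UNIV"
  by (simp add: gamma_law_def)

lemma emeasure_gamma_law:
  assumes "B \<in> sets borel"
  shows "emeasure (gamma_law s) B =
    (\<integral>\<^sup>+t. ennreal (indicator {0..} t * t powr (s - 1) / exp t / Gamma s) * indicator B t \<partial>lborel)"
  unfolding gamma_law_def by (rule emeasure_density) (use assms in auto)

lemma nn_integral_gamma_scaled: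
  assumes "s > 0" "c > 0"
  shows "(\<integral>\<^sup>+t. ennreal (indicator {0..} t * t powr (s - 1) * exp (- c * t)) \<partial>lborel) = ennreal (Gamma s / c powr s)"
proof -
  let ?f = "\<lambda>t. ennreal (indicator {0..} t * t powr (s - 1) * exp (- c * t))"
  have "(\<integral>\<^sup>+t. ?f t \<partial>lborel) = ennreal \<bar>1 / c\<bar> * (\<integral>\<^sup>+t. ?f (0 + (1 / c) * t) \<partial>lborel)"
    by (rule nn_integral_real_affine) (use assms in auto)
  also have "(\<integral>\<^sup>+t. ?f (0 + (1 / c) * t) \<partial>lborel) =
      (\<integral>\<^sup>+t. ennreal (1 / c powr (s - 1)) * ennreal (indicator {0..} t * t powr (s - 1) / exp t) \<partial>lborel)"
  proof (rule nn_integral_cong)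
    fix t :: real
    have eq: "(indicator {0..} (0 + 1 / c * t) :: real) * (0 + 1 / c * t) powr (s - 1) * exp (- c * (0 + 1 / c * t)) =
      1 / c powr (s - 1) * (indicator {0..} t * t powr (s - 1) / exp t)"
      using assms by (auto simp: indicator_def powr_divide exp_minus field_simps zero_le_divide_iff)
    have "0 \<le> 1 / c powr (s - 1)" by simp
    show "?f (0 + (1 / c) * t) =
        ennreal (1 / c powr (s - 1)) * ennreal (indicator {0..} t * t powr (s - 1) / exp t)"
      unfolding ennreal_mult'[OF \<open>0 \<le> 1 / c powr (s - 1)\<close>, symmetric] by (simp only: eq)
  qed
  also have "\<dots> = ennreal (1 / c powr (s - 1)) * ennreal (Gamma s)"
    by (subst nn_integral_cmult) (use Gamma_conv_nn_integral_real[OF assms(1)] in auto)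
  also have "ennreal \<bar>1 / c\<bar> * \<dots> = ennreal (Gamma s / c powr s)"
    using assms by (simp add: powr_diff flip: ennreal_mult')
  finally show ?thesis .
qed

lemma prob_space_gamma_law:
  assumes "s > 0"
  shows "prob_space (gamma_law s)"
proof
  have g: "Gamma s > 0" using assms by simp
  have "emeasure (gamma_law s) (space (gamma_law s)) =
      (\<integral>\<^sup>+t. ennreal (1 / Gamma s) * ennreal (indicator {0..} t * t powr (s - 1) / exp t) \<partial>lborel)"
    unfolding space_gamma_law
    by (subst emeasure_gamma_law, simp) (use g in \<open>auto intro!: nn_integral_cong simp flip: ennreal_mult'\<close>)
  also have "\<dots> = ennreal (1 / Gamma s) * ennreal (Gamma s)"
    by (subst nn_integral_cmult) (use Gamma_conv_nn_integral_real[OF assms(1)] in auto)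
  also have "\<dots> = 1" using g by (simp flip: ennreal_mult')
  finally show "emeasure (gamma_law s) (space (gamma_law s)) = 1" .
qed

text \<open>The large deviation rate: a gamma variable of shape \<open>s\<close> lies beyond \<open>T\<close>, on the side of \<open>T\<close> away
  from its mean \<open>s\<close>, with probability \<open>exp (- gamma_rate T s)\<close> up to polynomial factors.\<close>

definition gamma_rate :: "real \<Rightarrow> real \<Rightarrow> real" where
  "gamma_rate T s = T - s + s * ln (s / T)"

text \<open>Exponential tilting with parameter \<open>\<theta> = 1 - s / T\<close>, which moves the mean to \<open>T\<close>. The last hypothesis
  covers both tails, since \<open>\<theta>\<close> is negative for \<open>T < s\<close>.\<close>

lemma gamma_law_chernoff:
  assumes "s > 0" "T > 0" and B: "B \<in> sets borel"
    and le: "\<And>t. t \<in> B \<Longrightarrow> (1 - s / T) * T \<le> (1 - s / T) * t"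
  shows "measure (gamma_law s) B \<le> exp (- gamma_rate T s)"
proof -
  interpret prob_space "gamma_law s" by (rule prob_space_gamma_law) fact
  have g: "Gamma s > 0" using assms by simp
  let ?C = "exp (- (1 - s / T) * T) / Gamma s"
  have "emeasure (gamma_law s) B \<le>
      (\<integral>\<^sup>+t. ennreal ?C * ennreal (indicator {0..} t * t powr (s - 1) * exp (- (s / T) * t)) \<partial>lborel)"
    unfolding emeasure_gamma_law[OF B]
  proof (rule nn_integral_mono)
    fix t :: real
    show "ennreal (indicator {0..} t * t powr (s - 1) / exp t / Gamma s) * indicator B t \<le>
        ennreal ?C * ennreal (indicator {0..} t * t powr (s - 1) * exp (- (s / T) * t))"
    proof (cases "t \<in> B")
      case True
      have "exp (- t) = exp (- (1 - s / T) * t) * exp (- (s / T) * t)"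
        by (simp add: algebra_simps flip: exp_add)
      also have "\<dots> \<le> exp (- (1 - s / T) * T) * exp (- (s / T) * t)"
        using le[OF True] by (intro mult_right_mono) (simp_all only: exp_le_cancel_iff mult_minus_left neg_le_iff_le exp_ge_zero)
      finally have "exp (- t) \<le> exp (- (1 - s / T) * T) * exp (- (s / T) * t)" .
      then have "(indicator {0..} t * t powr (s - 1) / Gamma s) * exp (- t) \<le>
          (indicator {0..} t * t powr (s - 1) / Gamma s) * (exp (- (1 - s / T) * T) * exp (- (s / T) * t))"
        using g by (intro mult_left_mono) auto
      then have "indicator {0..} t * t powr (s - 1) / exp t / Gamma s \<le>
          ?C * (indicator {0..} t * t powr (s - 1) * exp (- (s / T) * t))"
        by (simp add: exp_minus divide_inverse mult_ac)
      then show ?thesis using True g by (simp add: ennreal_leI flip: ennreal_mult')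
    qed simp
  qed
  also have "\<dots> = ennreal ?C * ennreal (Gamma s / (s / T) powr s)"
    by (subst nn_integral_cmult) (use nn_integral_gamma_scaled[of s "s / T"] assms in auto)
  also have "\<dots> = ennreal (exp (- gamma_rate T s))"
  proof -
    have "(s / T) powr s = exp (s * ln (s / T))" using assms by (simp add: powr_def)
    moreover have "Gamma s \<noteq> 0" using g by (metis less_irrefl)
    ultimately have "?C * (Gamma s / (s / T) powr s) = exp (- (1 - s / T) * T) / exp (s * ln (s / T))" by simp
    also have "\<dots> = exp (- gamma_rate T s)"
      using assms by (simp add: gamma_rate_def algebra_simps flip: exp_diff)
    finally have "?C * (Gamma s / (s / T) powr s) = exp (- gamma_rate T s)" .
    then show ?thesis using g by (simp flip: ennreal_mult')
  qed
  finally show ?thesis by (simp add: emeasure_eq_measure)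
qed

lemma gamma_law_atMost_le:
  assumes "0 < T" "T \<le> s"
  shows "measure (gamma_law s) {..T} \<le> exp (- gamma_rate T s)"
proof (rule gamma_law_chernoff)
  fix t assume "t \<in> {..T}"
  moreover have "1 - s / T \<le> 0" using assms by simp
  ultimately show "(1 - s / T) * T \<le> (1 - s / T) * t" by (intro mult_left_mono_neg) auto
qed (use assms in auto)

lemma gamma_law_atLeast_le:
  assumes "0 < s" "s \<le> T"
  shows "measure (gamma_law s) {T..} \<le> exp (- gamma_rate T s)"
proof (rule gamma_law_chernoff)
  fix t assume "t \<in> {T..}"
  moreover have "0 \<le> 1 - s / T" using assms by simp
  ultimately show "(1 - s / T) * T \<le> (1 - s / T) * t" by (intro mult_left_mono) auto
qed (use assms in auto)

text \<open>Stirling's upper bound up to a linear factor. The integrand \<open>t powr s / exp t\<close> is split as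
  \<open>t powr s * exp (- (s / (s + 1)) * t)\<close>, whose maximum is at \<open>t = s + 1\<close>, times \<open>exp (- t / (s + 1))\<close>.\<close>

lemma Gamma_plus1_le:
  fixes s :: real
  assumes "s > 0"
  shows "Gamma (s + 1) \<le> exp 1 * (s + 1) * exp (s * ln s - s)"
proof -
  have *: "t powr s / exp t \<le> (exp 1 * exp (s * ln s - s)) * exp (- (1 / (s + 1)) * t)" if "t \<ge> 0" for t :: real
  proof (cases "t = 0")
    case False
    then have t: "t > 0" using that by simp
    have "ln (t / (s + 1)) \<le> t / (s + 1) - 1" using t assms by (intro ln_le_minus_one) auto
    then have "s * ln t - s * ln (s + 1) \<le> s * (t / (s + 1) - 1)"
      using mult_left_mono[of "ln (t / (s + 1))" "t / (s + 1) - 1" s] t assms by (simp add: ln_div right_diff_distrib)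
    moreover have "ln ((s + 1) / s) \<le> (s + 1) / s - 1" using assms by (intro ln_le_minus_one) auto
    then have "s * ln (s + 1) - s * ln s \<le> 1"
      using mult_left_mono[of "ln ((s + 1) / s)" "(s + 1) / s - 1" s] assms by (simp add: ln_div right_diff_distrib)
    moreover have "s * (t / (s + 1) - 1) - t = - s - (1 / (s + 1)) * t"
      using assms by (simp add: field_simps)
    ultimately have "s * ln t - t \<le> 1 + (s * ln s - s) + - (1 / (s + 1)) * t" by linarith
    then have "exp (s * ln t - t) \<le> exp (1 + (s * ln s - s) + - (1 / (s + 1)) * t)" by simp
    then show ?thesis using t by (simp only: powr_def exp_diff exp_add) simp
  qed (use assms in auto)
  have "ennreal (Gamma (s + 1)) = (\<integral>\<^sup>+t. ennreal (indicator {0..} t * t powr s / exp t) \<partial>lborel)"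
    using Gamma_conv_nn_integral_real[of "s + 1"] assms by simp
  also have "\<dots> \<le> (\<integral>\<^sup>+t. ennreal (exp 1 * exp (s * ln s - s)) *
      ennreal (indicator {0..} t * t powr (1 - 1) * exp (- (1 / (s + 1)) * t)) \<partial>lborel)"
  proof (rule nn_integral_mono_AE, rule AE_mp[OF AE_lborel_singleton[of 0] AE_I2], rule impI)
    fix t :: real assume "t \<noteq> 0"
    have "indicator {0..} t * t powr s / exp t \<le>
        (exp 1 * exp (s * ln s - s)) * (indicator {0..} t * t powr (1 - 1) * exp (- (1 / (s + 1)) * t))"
      using *[of t] \<open>t \<noteq> 0\<close> by (cases "t \<ge> 0") auto
    then show "ennreal (indicator {0..} t * t powr s / exp t) \<le> ennreal (exp 1 * exp (s * ln s - s)) *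
        ennreal (indicator {0..} t * t powr (1 - 1) * exp (- (1 / (s + 1)) * t))"
      by (simp add: ennreal_leI flip: ennreal_mult')
  qed
  also have "\<dots> = ennreal (exp 1 * exp (s * ln s - s)) * ennreal (Gamma 1 / (1 / (s + 1)) powr 1)"
    by (subst nn_integral_cmult) (use nn_integral_gamma_scaled[of 1 "1 / (s + 1)"] assms in auto)
  also have "\<dots> = ennreal (exp 1 * (s + 1) * exp (s * ln s - s))"
  proof -
    have "0 \<le> exp 1 * exp (s * ln s - s)" by simp
    then show ?thesis
      unfolding ennreal_mult'[OF \<open>0 \<le> exp 1 * exp (s * ln s - s)\<close>, symmetric] using assms by (simp add: mult_ac)
  qed
  finally show ?thesis using assms by (subst (asm) ennreal_le_iff) auto
qed

lemma gamma_stirling_ratio: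
  assumes "s > 0" "T > 0"
  shows "exp (- gamma_rate T s) / (exp 1 * (s + 1)) \<le> exp (- T) * T powr s / Gamma (s + 1)"
proof -
  have eq: "exp (- gamma_rate T s) = exp (- T) * T powr s / exp (s * ln s - s)"
    using assms by (simp add: gamma_rate_def powr_def ln_div right_diff_distrib flip: exp_add exp_diff)
  have "exp (- T) * T powr s / (exp 1 * (s + 1) * exp (s * ln s - s)) \<le> exp (- T) * T powr s / Gamma (s + 1)"
    using Gamma_plus1_le[OF assms(1)] assms by (intro divide_left_mono) auto
  then show ?thesis unfolding eq by (simp add: mult_ac)
qed

lemma gamma_law_atMost_ge:
  assumes "s > 0" "T > 0"
  shows "exp (- gamma_rate T s) / (exp 1 * (s + 1)) \<le> measure (gamma_law s) {..T}"
proof -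
  interpret prob_space "gamma_law s" by (rule prob_space_gamma_law) fact
  have g: "Gamma s > 0" using assms by simp
  have "((\<lambda>t. t powr (s - 1)) has_integral (T powr (s - 1 + 1) / (s - 1 + 1))) {0..T}"
    by (rule has_integral_powr_from_0) (use assms in auto)
  from nn_integral_has_integral_lebesgue'[OF _ this]
  have int: "(\<integral>\<^sup>+t. ennreal (t powr (s - 1)) * indicator {0..T} t \<partial>lborel) = ennreal (T powr s / s)" by simp
  have "ennreal (exp (- T) * T powr s / Gamma (s + 1)) = ennreal (exp (- T) / Gamma s) * ennreal (T powr s / s)"
    using assms g Gamma_plus1[of s] by (simp add: nonpos_Ints_def flip: ennreal_mult')
  also have "\<dots> = (\<integral>\<^sup>+t. ennreal (exp (- T) / Gamma s) * (ennreal (t powr (s - 1)) * indicator {0..T} t) \<partial>lborel)"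
    by (subst nn_integral_cmult) (use int in auto)
  also have "\<dots> \<le> emeasure (gamma_law s) {..T}"
    unfolding emeasure_gamma_law[OF borel_closed[OF closed_atMost]]
  proof (rule nn_integral_mono)
    fix t :: real
    show "ennreal (exp (- T) / Gamma s) * (ennreal (t powr (s - 1)) * indicator {0..T} t) \<le>
        ennreal (indicator {0..} t * t powr (s - 1) / exp t / Gamma s) * indicator {..T} t"
    proof (cases "t \<in> {0..T}")
      case True
      have "exp (- T) \<le> exp (- t)" using True by simp
      then have "exp (- T) * (t powr (s - 1) / Gamma s) \<le> exp (- t) * (t powr (s - 1) / Gamma s)"
        using g by (intro mult_right_mono) auto
      then have "exp (- T) / Gamma s * t powr (s - 1) \<le> t powr (s - 1) / exp t / Gamma s"
        by (simp add: exp_minus divide_inverse mult_ac)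
      then show ?thesis using True g by (simp add: ennreal_leI flip: ennreal_mult')
    qed simp
  qed
  finally have "exp (- T) * T powr s / Gamma (s + 1) \<le> measure (gamma_law s) {..T}"
    by (simp add: emeasure_eq_measure)
  with gamma_stirling_ratio[OF assms] show ?thesis by linarith
qed

lemma gamma_upper_integral_ge:
  assumes "s \<ge> 1" "T > 0"
  shows "T powr (s - 1) * exp (- T) / Gamma s \<le> measure (gamma_law s) {T..}"
proof -
  have s: "s > 0" using assms by simp
  interpret prob_space "gamma_law s" by (rule prob_space_gamma_law) fact
  have g: "Gamma s > 0" using s by simp
  have "((\<lambda>t. exp (- 1 * t)) has_integral (exp (- 1 * T) / 1)) {T..}"
    by (rule has_integral_exp_minus_to_infinity) simp
  from nn_integral_has_integral_lebesgue'[OF _ this]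
  have int: "(\<integral>\<^sup>+t. ennreal (exp (- t)) * indicator {T..} t \<partial>lborel) = ennreal (exp (- T))" by simp
  have "ennreal (T powr (s - 1) * exp (- T) / Gamma s) = ennreal (T powr (s - 1) / Gamma s) * ennreal (exp (- T))"
    using g by (simp flip: ennreal_mult')
  also have "\<dots> = (\<integral>\<^sup>+t. ennreal (T powr (s - 1) / Gamma s) * (ennreal (exp (- t)) * indicator {T..} t) \<partial>lborel)"
    by (subst nn_integral_cmult) (use int in auto)
  also have "\<dots> \<le> emeasure (gamma_law s) {T..}"
    unfolding emeasure_gamma_law[OF borel_closed[OF closed_atLeast]]
  proof (rule nn_integral_mono)
    fix t :: real
    show "ennreal (T powr (s - 1) / Gamma s) * (ennreal (exp (- t)) * indicator {T..} t) \<le>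
        ennreal (indicator {0..} t * t powr (s - 1) / exp t / Gamma s) * indicator {T..} t"
    proof (cases "t \<in> {T..}")
      case True
      have "T powr (s - 1) \<le> t powr (s - 1)" using True assms by (intro powr_mono2) auto
      then have "T powr (s - 1) * (exp (- t) / Gamma s) \<le> t powr (s - 1) * (exp (- t) / Gamma s)"
        using g by (intro mult_right_mono) auto
      then have "T powr (s - 1) / Gamma s * exp (- t) \<le> t powr (s - 1) / exp t / Gamma s"
        by (simp add: exp_minus divide_inverse mult_ac)
      then show ?thesis using True g assms by (simp add: ennreal_leI flip: ennreal_mult')
    qed simp
  qed
  finally show ?thesis by (simp add: emeasure_eq_measure)
qed

lemma gamma_law_atLeast_ge:
  assumes "s \<ge> 1" "T > 0"
  shows "s / T * (exp (- gamma_rate T s) / (exp 1 * (s + 1))) \<le> measure (gamma_law s) {T..}"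
proof -
  have s: "s > 0" using assms by simp
  have "s / T * (exp (- gamma_rate T s) / (exp 1 * (s + 1))) \<le> s / T * (exp (- T) * T powr s / Gamma (s + 1))"
    using gamma_stirling_ratio[OF s assms(2)] s assms by (intro mult_left_mono) auto
  also have "\<dots> = T powr (s - 1) * exp (- T) / Gamma s"
    using assms s Gamma_plus1[of s] by (simp add: powr_diff nonpos_Ints_def field_simps)
  also have "\<dots> \<le> measure (gamma_law s) {T..}" by (rule gamma_upper_integral_ge) fact+
  finally show ?thesis .
qed

lemma summable_power_over_Gamma:
  fixes a x :: real
  assumes "a > 0" "x \<ge> 0"
  shows "summable (\<lambda>k. x ^ k / Gamma (a * real k + a))"
proof -
  \<comment> \<open>With this threshold the lower bound on the Gamma function beats the power by a geometric factor.\<close>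
  define T where "T = (2 * x + 1) powr (1 / a)"
  have T: "T > 0" "T powr a = 2 * x + 1" using assms by (auto simp: T_def powr_powr)
  have y: "x / (2 * x + 1) \<ge> 0" "x / (2 * x + 1) < 1" using assms by (auto simp: field_simps)
  obtain N :: nat where N: "1 / a \<le> real N" using real_arch_simple by blast
  show ?thesis
  proof (rule summable_comparison_test')
    show "summable (\<lambda>k. (exp T * T / T powr a) * (x / (2 * x + 1)) ^ k)"
      using y by (intro summable_mult summable_geometric) (simp only: real_norm_def abs_of_nonneg)
    fix k assume "k \<ge> N"
    then have "1 / a \<le> real k" using N by linarith
    then have "1 \<le> a * real k" using assms by (simp add: field_simps)
    then have s: "a * real k + a \<ge> 1" using assms by linarith
    let ?s = "a * real k + a"
    interpret prob_space "gamma_law ?s" by (rule prob_space_gamma_law) (use s in simp)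
    have g: "Gamma ?s > 0" using s by simp
    have "T powr (?s - 1) * exp (- T) / Gamma ?s \<le> 1"
      using gamma_upper_integral_ge[OF s T(1)] prob_le_1 order_trans by blast
    then have "T powr (?s - 1) * exp (- T) \<le> Gamma ?s" using g by (simp add: field_simps)
    then have "x ^ k / Gamma ?s \<le> x ^ k / (T powr (?s - 1) * exp (- T))"
      using assms T g by (intro divide_left_mono) auto
    also have "T powr (?s - 1) = (2 * x + 1) ^ k * T powr a / T"
    proof -
      have "T powr (a * real k) = (2 * x + 1) ^ k"
        using T assms by (simp add: powr_powr[symmetric] powr_realpow)
      then show ?thesis using T by (simp add: powr_diff powr_add)
    qed
    also have "x ^ k / ((2 * x + 1) ^ k * T powr a / T * exp (- T)) = (exp T * T / T powr a) * (x / (2 * x + 1)) ^ k"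
      by (simp add: exp_minus field_simps power_divide)
    finally show "norm (x ^ k / Gamma ?s) \<le> (exp T * T / T powr a) * (x / (2 * x + 1)) ^ k"
      using assms g by simp
  qed
qed

section \<open>The Mittag-Leffler kernel on an annulus\<close>

text \<open>The argument of the Gamma function in the \<open>j\<close>-th term of the Mittag-Leffler series, \<open>2 (j + 1) / \<alpha>\<close>.\<close>

definition ml_shape :: "real \<Rightarrow> nat \<Rightarrow> real" where
  "ml_shape \<alpha> j = 2 / \<alpha> * real j + 2 / \<alpha>"

lemma ml_shape_pos: "\<alpha> > 0 \<Longrightarrow> ml_shape \<alpha> j > 0"
  unfolding ml_shape_def by (intro add_nonneg_pos) auto

lemma nn_integral_annulus_monomial:
  assumes "\<alpha> > 0" "0 < a" "0 \<le> b"
  shows "(\<integral>\<^sup>+z. ennreal (cmod z ^ (2 * j) * exp (- (cmod z powr \<alpha>)) * indicator {a<..<b} (cmod z)) \<partial>(lborel :: complex measure)) =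
    ennreal (2 * pi / \<alpha> * Gamma (ml_shape \<alpha> j)) * emeasure (gamma_law (ml_shape \<alpha> j)) {a powr \<alpha><..<b powr \<alpha>}"
proof -
  let ?s = "ml_shape \<alpha> j"
  let ?B = "{a powr \<alpha><..<b powr \<alpha>}"
  have g: "Gamma ?s > 0" using ml_shape_pos[OF assms(1)] by simp
  let ?g = "\<lambda>t. ennreal (t powr (2 * real j / \<alpha>) * exp (- t) * indicator ?B t)"
  have "(\<integral>\<^sup>+z. ennreal (cmod z ^ (2 * j) * exp (- (cmod z powr \<alpha>)) * indicator {a<..<b} (cmod z)) \<partial>(lborel :: complex measure)) =
      (\<integral>\<^sup>+z. ?g (cmod z powr \<alpha>) \<partial>(lborel :: complex measure))"
  proof (rule nn_integral_cong)
    fix z :: complex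
    have mono: "x powr \<alpha> < y powr \<alpha> \<longleftrightarrow> x < y" if "0 \<le> x" "0 \<le> y" for x y
      using powr_less_mono2[OF assms(1) that(1), of y] powr_mono2[OF less_imp_le[OF assms(1)] that(2), of x] by linarith
    have ind: "indicator {a<..<b} (cmod z) = (indicator ?B (cmod z powr \<alpha>) :: real)"
      using mono[of a "cmod z"] mono[of "cmod z" b] assms by (simp add: indicator_def)
    show "ennreal (cmod z ^ (2 * j) * exp (- (cmod z powr \<alpha>)) * indicator {a<..<b} (cmod z)) = ?g (cmod z powr \<alpha>)"
    proof (cases "cmod z \<in> {a<..<b}")
      case True
      then have "cmod z > 0" using assms(2) unfolding greaterThanLessThan_iff by linarith
      moreover have "(cmod z powr \<alpha>) powr (2 * real j / \<alpha>) = cmod z powr real (2 * j)"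
        using assms by (simp add: powr_powr)
      ultimately have "(cmod z powr \<alpha>) powr (2 * real j / \<alpha>) = cmod z ^ (2 * j)"
        by (simp only: powr_realpow)
      then show ?thesis by (simp only: ind)
    next
      case False
      then have "indicator {a<..<b} (cmod z) = (0 :: real)" by simp
      then show ?thesis using ind by simp
    qed
  qed
  also have "\<dots> = (\<integral>\<^sup>+t. ennreal (2 * pi / \<alpha> * t powr (2 / \<alpha> - 1)) * indicator {0..} t * ?g t \<partial>lborel)"
    by (rule nn_integral_radial[OF assms(1)]) auto
  also have "\<dots> = (\<integral>\<^sup>+t. ennreal (2 * pi / \<alpha> * Gamma ?s) *
      (ennreal (indicator {0..} t * t powr (?s - 1) / exp t / Gamma ?s) * indicator ?B t) \<partial>lborel)"
  proof (rule nn_integral_cong)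
    fix t :: real
    show "ennreal (2 * pi / \<alpha> * t powr (2 / \<alpha> - 1)) * indicator {0..} t * ?g t =
        ennreal (2 * pi / \<alpha> * Gamma ?s) * (ennreal (indicator {0..} t * t powr (?s - 1) / exp t / Gamma ?s) * indicator ?B t)"
    proof (cases "t \<in> ?B")
      case True
      then have t: "t > 0" using le_less_trans[of 0 "a powr \<alpha>" t] by simp
      have "t powr (?s - 1) = t powr (2 / \<alpha> - 1) * t powr (2 * real j / \<alpha>)"
        by (simp add: ml_shape_def algebra_simps flip: powr_add)
      then have "2 * pi / \<alpha> * t powr (2 / \<alpha> - 1) * (t powr (2 * real j / \<alpha>) * exp (- t)) =
          2 * pi / \<alpha> * Gamma ?s * (t powr (?s - 1) / exp t / Gamma ?s)"
        using g by (simp add: exp_minus divide_inverse)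
      then show ?thesis using True t assms g by (simp flip: ennreal_mult')
    qed simp
  qed
  also have "\<dots> = ennreal (2 * pi / \<alpha> * Gamma ?s) * emeasure (gamma_law ?s) ?B"
    by (subst nn_integral_cmult) (simp_all add: emeasure_gamma_law)
  finally show ?thesis .
qed

context
  fixes \<alpha> a b :: real
begin

text \<open>The open annulus with radii \<open>a\<close> and \<open>b\<close>.\<close>

definition shell :: "complex set" where "shell = {z. a < cmod z \<and> cmod z < b}"

text \<open>The \<open>j\<close>-th term of the kernel at \<open>(z, w)\<close> is \<open>ml_left j z * ml_right j w\<close>; the normalization is put
  entirely into the left factor.\<close>

definition ml_left :: "nat \<Rightarrow> complex \<Rightarrow> complex" where
  "ml_left j z = complex_of_real (\<alpha> / (2 * pi) / Gamma (ml_shape \<alpha> j) * exp (- (cmod z powr \<alpha>) / 2)) * z ^ j"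

definition ml_right :: "nat \<Rightarrow> complex \<Rightarrow> complex" where
  "ml_right j w = complex_of_real (exp (- (cmod w powr \<alpha>) / 2)) * cnj w ^ j"

text \<open>A bound on the \<open>j\<close>-th term of the kernel on the annulus.\<close>

definition ml_bound :: "nat \<Rightarrow> real" where
  "ml_bound j = \<alpha> / (2 * pi) * ((b\<^sup>2) ^ j / Gamma (ml_shape \<alpha> j))"

text \<open>The probability that a gamma variable of shape \<open>ml_shape \<alpha> j\<close> falls between \<open>a powr \<alpha>\<close> and \<open>b powr \<alpha>\<close>;
  these are the diagonal integrals in \<open>ml_orthogonal\<close>.\<close>

definition shell_prob :: "nat \<Rightarrow> real" where
  "shell_prob j = measure (gamma_law (ml_shape \<alpha> j)) {a powr \<alpha><..<b powr \<alpha>}"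

context
  assumes \<alpha>: "\<alpha> > 0" and a: "0 < a" and b: "a < b"
begin

lemma Gamma_ml_shape: "Gamma (ml_shape \<alpha> j) > 0"
  using ml_shape_pos[OF \<alpha>] by simp

lemma sets_shell: "shell \<in> sets borel" "bounded shell"
proof -
  have "shell = {z \<in> space borel. a < cmod z \<and> cmod z < b}" by (simp add: shell_def)
  also have "\<dots> \<in> sets borel" by measurable
  finally show "shell \<in> sets borel" .
  show "bounded shell" unfolding bounded_iff shell_def by (rule exI[of _ b]) auto
qed

lemma summable_ml_bound: "summable ml_bound"
  unfolding ml_bound_def ml_shape_def
  by (intro summable_mult summable_power_over_Gamma) (use \<alpha> in auto)

lemma norm_ml_le:
  assumes "z \<in> shell" "w \<in> shell"
  shows "norm (ml_left i z * ml_right j w) \<le> \<alpha> / (2 * pi) / Gamma (ml_shape \<alpha> i) * b ^ i * b ^ j"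
proof -
  have zw: "cmod z \<le> b" "cmod w \<le> b" using assms by (auto simp: shell_def)
  have c: "0 < \<alpha> / (2 * pi) / Gamma (ml_shape \<alpha> i)" using \<alpha> Gamma_ml_shape[of i] by simp
  have "norm (ml_left i z * ml_right j w) =
      (\<alpha> / (2 * pi) / Gamma (ml_shape \<alpha> i)) * exp (- (cmod z powr \<alpha>) / 2) * cmod z ^ i * (exp (- (cmod w powr \<alpha>) / 2) * cmod w ^ j)"
    by (simp only: ml_left_def ml_right_def norm_mult norm_power norm_of_real complex_mod_cnj
          abs_mult abs_of_pos[OF c] abs_exp_cancel)
  also have "\<dots> \<le> (\<alpha> / (2 * pi) / Gamma (ml_shape \<alpha> i)) * 1 * b ^ i * (1 * b ^ j)"
    by (intro mult_mono power_mono mult_nonneg_nonneg zero_le_power norm_ge_zero exp_ge_zero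
          zw less_imp_le[OF c] order_refl zero_le_one) (use a b in auto)
  finally show ?thesis by simp
qed

lemma norm_ml_le_bound:
  assumes "z \<in> shell" "w \<in> shell"
  shows "norm (ml_left j z * ml_right j w) \<le> ml_bound j"
  using norm_ml_le[OF assms, of j j] by (simp add: ml_bound_def power2_eq_square power_mult_distrib mult.assoc)

lemma measurable_ml: "ml_left j \<in> borel_measurable borel" "ml_right j \<in> borel_measurable borel"
  unfolding ml_left_def ml_right_def using borel_measurable_cnj by measurable

lemma integrable_ml: "integrable lborel (\<lambda>z. indicator shell z * ml_left i z * ml_right j z)"
proof (rule integrableI_bounded_set)
  show "shell \<in> sets lborel" using sets_shell by simp
  show "(\<lambda>z. indicator shell z * ml_left i z * ml_right j z) \<in> borel_measurable lborel"
    by (intro borel_measurable_times borel_measurable_indicator) (simp_all add: measurable_ml sets_shell)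
  show "emeasure lborel shell < \<infinity>" using emeasure_bounded_finite[OF sets_shell(2)] .
  show "AE z in lborel. z \<in> shell \<longrightarrow> norm (indicator shell z * ml_left i z * ml_right j z) \<le>
      \<alpha> / (2 * pi) / Gamma (ml_shape \<alpha> i) * b ^ i * b ^ j"
    using norm_ml_le by (intro AE_I2) auto
qed auto

lemma ml_orthogonal:
  "(\<integral>z. indicator shell z * ml_left i z * ml_right j z \<partial>lborel) = (if i = j then complex_of_real (shell_prob j) else 0)"
proof -
  let ?c = "\<alpha> / (2 * pi) / Gamma (ml_shape \<alpha> i)"
  let ?g = "\<lambda>t. ?c * exp (- (t powr \<alpha>)) * indicator {a<..<b} t"
  have eq: "indicator shell z * ml_left i z * ml_right j z = z ^ i * cnj z ^ j * complex_of_real (?g (cmod z))" for z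
  proof -
    have "exp (- (cmod z powr \<alpha>)) = exp (- (cmod z powr \<alpha>) / 2) * exp (- (cmod z powr \<alpha>) / 2)"
      by (simp flip: exp_add)
    then show ?thesis by (simp add: ml_left_def ml_right_def shell_def indicator_def)
  qed
  show ?thesis
  proof (cases "i = j")
    case False
    have "(\<integral>z. z ^ i * cnj z ^ j * complex_of_real (?g (cmod z)) \<partial>lborel) = 0"
      by (rule integral_monomials_radial_eq_0[OF _ False]) measurable
    then show ?thesis using False by (simp only: eq if_False)
  next
    case True
    interpret prob_space "gamma_law (ml_shape \<alpha> j)" by (rule prob_space_gamma_law[OF ml_shape_pos[OF \<alpha>]])
    have c: "?c > 0" using \<alpha> Gamma_ml_shape[of i] by simp
    let ?h = "\<lambda>z. cmod z ^ (2 * i) * exp (- (cmod z powr \<alpha>)) * indicator {a<..<b} (cmod z)"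
    have eq2: "z ^ i * cnj z ^ j * complex_of_real (?g (cmod z)) = complex_of_real (?c * ?h z)" for z
    proof -
      have "z ^ i * cnj z ^ j = complex_of_real (cmod z ^ (2 * i))"
      proof -
        have "z ^ i * cnj z ^ j = (z * cnj z) ^ i" using True by (simp add: power_mult_distrib)
        also have "\<dots> = complex_of_real ((cmod z)\<^sup>2) ^ i" by (simp only: complex_norm_square)
        finally show ?thesis by (simp add: power_mult)
      qed
      then show ?thesis by simp
    qed
    have m: "(\<lambda>z. ?c * ?h z) \<in> borel_measurable lborel" by measurable
    have "(\<integral>\<^sup>+z. ennreal (?c * ?h z) \<partial>lborel) = ennreal ?c * (\<integral>\<^sup>+z. ennreal (?h z) \<partial>lborel)"
      unfolding ennreal_mult'[OF less_imp_le[OF c]] by (rule nn_integral_cmult) measurable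
    also have "\<dots> = ennreal ?c * (ennreal (2 * pi / \<alpha> * Gamma (ml_shape \<alpha> i)) * ennreal (shell_prob j))"
      unfolding nn_integral_annulus_monomial[OF \<alpha> a order.strict_implies_order[OF order.strict_trans[OF a b]]] shell_prob_def True emeasure_eq_measure ..
    also have "\<dots> = ennreal (?c * (2 * pi / \<alpha> * Gamma (ml_shape \<alpha> i))) * ennreal (shell_prob j)"
      unfolding ennreal_mult'[OF less_imp_le[OF c]] by (simp only: mult.assoc)
    also have "?c * (2 * pi / \<alpha> * Gamma (ml_shape \<alpha> i)) = 1"
    proof -
      have "Gamma (ml_shape \<alpha> i) \<noteq> 0" using Gamma_ml_shape[of i] by (metis less_irrefl)
      then show ?thesis using \<alpha> by simp
    qed
    finally have nn: "(\<integral>\<^sup>+z. ennreal (?c * ?h z) \<partial>lborel) = ennreal (shell_prob j)" by simp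
    have "(\<integral>z. ?c * ?h z \<partial>lborel) = enn2real (\<integral>\<^sup>+z. ennreal (?c * ?h z) \<partial>lborel)"
      by (rule integral_eq_nn_integral[OF m], intro AE_I2 mult_nonneg_nonneg less_imp_le[OF c]) auto
    also have "\<dots> = shell_prob j" unfolding nn by (simp add: shell_prob_def)
    finally have "(\<integral>z. complex_of_real (?c * ?h z) \<partial>lborel) = complex_of_real (shell_prob j)"
      by (simp only: integral_complex_of_real)
    then show ?thesis unfolding eq eq2 using True by (simp only: refl if_True)
  qed
qed

lemma summable_shell_prob: "summable shell_prob"
proof (rule summable_comparison_test')
  show "summable (\<lambda>j. ml_bound j * measure lborel shell)"
    by (intro summable_mult2 summable_ml_bound)
  fix j
  have "norm (shell_prob j) = norm (\<integral>z. indicator shell z * ml_left j z * ml_right j z \<partial>lborel)"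
    by (simp add: ml_orthogonal)
  also have "\<dots> \<le> (\<integral>z. norm (indicator shell z * ml_left j z * ml_right j z) \<partial>lborel)"
    by (rule integral_norm_bound)
  also have "\<dots> \<le> (\<integral>z. ml_bound j * indicator shell z \<partial>lborel)"
  proof (rule integral_mono)
    show "integrable lborel (\<lambda>z. norm (indicator shell z * ml_left j z * ml_right j z))"
      using integrable_ml by (rule integrable_norm)
    show "integrable lborel (\<lambda>z. ml_bound j * indicator shell z :: real)"
      using sets_shell emeasure_bounded_finite[OF sets_shell(2)] by (intro integrable_mult_right integrable_real_indicator) auto
    show "norm (indicator shell z * ml_left j z * ml_right j z) \<le> ml_bound j * indicator shell z" for z
      using norm_ml_le_bound[of z z j] by (cases "z \<in> shell") auto
  qed
  also have "\<dots> = ml_bound j * measure lborel shell" by simp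
  finally show "norm (shell_prob j) \<le> ml_bound j * measure lborel shell" .
qed

lemma ml_kernel_sums:
  assumes "z \<in> shell" "w \<in> shell"
  shows "(\<lambda>j. ml_left j z * ml_right j w) sums mittag_leffler_kernel \<alpha> z w"
proof -
  let ?u = "\<lambda>k. (z * cnj w) ^ k / complex_of_real (Gamma (2 / \<alpha> * real k + 2 / \<alpha>))"
  have "summable (\<lambda>k. (cmod z * cmod w) ^ k / Gamma (2 / \<alpha> * real k + 2 / \<alpha>))"
    by (rule summable_power_over_Gamma) (use \<alpha> in auto)
  moreover have "norm (?u k) = (cmod z * cmod w) ^ k / Gamma (2 / \<alpha> * real k + 2 / \<alpha>)" for k
    using Gamma_ml_shape[of k] by (simp add: norm_divide norm_power norm_mult ml_shape_def)
  ultimately have "summable (\<lambda>k. norm (?u k))" by (simp only:)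
  then have "?u sums (\<Sum>k. ?u k)" by (rule summable_sums[OF summable_norm_cancel])
  then have u: "?u sums mittag_leffler (2 / \<alpha>) (2 / \<alpha>) (z * cnj w)" unfolding mittag_leffler_def .
  have eq: "complex_of_real (\<alpha> / (2 * pi)) * ?u k * complex_of_real (exp (- (cmod z powr \<alpha>) / 2 - (cmod w powr \<alpha>) / 2)) =
      ml_left k z * ml_right k w" for k
  proof -
    have "exp (- (cmod z powr \<alpha>) / 2 - (cmod w powr \<alpha>) / 2) = exp (- (cmod z powr \<alpha>) / 2) * exp (- (cmod w powr \<alpha>) / 2)"
      using exp_add[of "- (cmod z powr \<alpha>) / 2" "- (cmod w powr \<alpha>) / 2"] by simp
    then show ?thesis
      unfolding ml_left_def ml_right_def ml_shape_def power_mult_distrib by simp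
  qed
  show ?thesis
    using sums_mult2[OF sums_mult[OF u, of "complex_of_real (\<alpha> / (2 * pi))"],
        of "complex_of_real (exp (- (cmod z powr \<alpha>) / 2 - (cmod w powr \<alpha>) / 2))"]
    unfolding eq mittag_leffler_kernel_def .
qed

theorem ml_void_probability:
  assumes "determinantal_process M X (mittag_leffler_kernel \<alpha>)"
  shows "(\<lambda>n. \<Prod>j<n. 1 - shell_prob j) \<longlonglongrightarrow> measure M {\<omega> \<in> space M. num_points X shell \<omega> = 0}"
proof (rule determinantal_void_probability[where P = ml_left and Q = ml_right and b = ml_bound
      and K = "mittag_leffler_kernel \<alpha>"])
  show "0 \<le> shell_prob j" for j by (simp add: shell_prob_def)
  show "shell \<in> sets borel" "bounded shell" by (rule sets_shell)+
  show "ml_left j \<in> borel_measurable borel" "ml_right j \<in> borel_measurable borel" for j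
    by (rule measurable_ml)+
  show "norm (ml_left j z * ml_right j w) \<le> ml_bound j" if "z \<in> shell" "w \<in> shell" for j z w
    using that by (rule norm_ml_le_bound)
  show "(\<lambda>j. ml_left j z * ml_right j w) sums mittag_leffler_kernel \<alpha> z w" if "z \<in> shell" "w \<in> shell" for z w
    using that by (rule ml_kernel_sums)
qed (rule summable_ml_bound integrable_ml ml_orthogonal summable_shell_prob assms)+

end

end

section \<open>Riemann sums, the rate function and its integral, gap probabilities\<close>

text \<open>Riemann sums over \<open>[0, 1]\<close> at the right end points of intervals of length \<open>\<delta>\<close>. The sum may run past \<open>1\<close>,
  where the function vanishes, so the number of intervals need not be exact.\<close>

lemma riemann_sum_tendsto:
  fixes f :: "real \<Rightarrow> real" and \<delta> :: "'a \<Rightarrow> real" and N :: "'a \<Rightarrow> nat"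
  assumes cont: "continuous_on {0..B} f" and zero: "\<And>u. u \<ge> 1 \<Longrightarrow> f u = 0"
    and \<delta>: "(\<delta> \<longlongrightarrow> 0) F" "\<forall>\<^sub>F x in F. \<delta> x > 0"
    and N: "\<forall>\<^sub>F x in F. 1 \<le> \<delta> x * real (N x) \<and> \<delta> x * real (N x) \<le> B"
  shows "((\<lambda>x. \<delta> x * (\<Sum>j<N x. f (\<delta> x * (real j + 1)))) \<longlongrightarrow> integral {0..1} f) F"
proof (rule tendstoI)
  fix e :: real assume e: "e > 0"
  define e' where "e' = e / (2 * (\<bar>B\<bar> + 1))"
  have e': "e' > 0" using e by (simp add: e'_def add_nonneg_pos)
  have "uniformly_continuous_on {0..B} f" by (rule compact_uniformly_continuous[OF cont]) simp
  then obtain d where d: "d > 0" and uc: "\<And>u v. u \<in> {0..B} \<Longrightarrow> v \<in> {0..B} \<Longrightarrow> dist u v < d \<Longrightarrow> dist (f u) (f v) < e'"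
    unfolding uniformly_continuous_on_def using e' by metis
  have "\<forall>\<^sub>F x in F. \<delta> x < d" using \<delta>(1) d by (rule order_tendstoD)
  with \<delta>(2) N show "\<forall>\<^sub>F x in F. dist (\<delta> x * (\<Sum>j<N x. f (\<delta> x * (real j + 1)))) (integral {0..1} f) < e"
  proof eventually_elim
    fix x assume \<delta>x: "\<delta> x > 0" and Nx: "1 \<le> \<delta> x * real (N x) \<and> \<delta> x * real (N x) \<le> B" and dx: "\<delta> x < d"
    let ?d = "\<delta> x"
    have int: "f integrable_on {u..v}" if "0 \<le> u" "v \<le> B" for u v
      by (rule integrable_continuous_real, rule continuous_on_subset[OF cont]) (use that in auto)
    have *: "n \<le> N x \<Longrightarrow> \<bar>?d * (\<Sum>j<n. f (?d * (real j + 1))) - integral {0..?d * real n} f\<bar> \<le> real n * (?d * e')" for n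
    proof (induction n)
      case (Suc n)
      let ?I = "integral {?d * real n..?d * real (Suc n)} f"
      have le: "?d * real n \<le> ?d * real (Suc n)" using \<delta>x by (intro mult_left_mono) auto
      have "?d * real (Suc n) \<le> ?d * real (N x)" using Suc.prems \<delta>x by (intro mult_left_mono) auto
      then have leB: "?d * real (Suc n) \<le> B" using Nx by linarith
      have nn: "0 \<le> ?d * real n" using \<delta>x by simp
      have comb: "integral {0..?d * real n} f + ?I = integral {0..?d * real (Suc n)} f"
        using nn le leB by (intro Henstock_Kurzweil_Integration.integral_combine int) auto
      have "norm (integral {?d * real n..?d * real (Suc n)} (\<lambda>u. f (?d * (real n + 1)) - f u)) \<le> e' * (?d * real (Suc n) - ?d * real n)"
      proof (rule integral_bound)
        show "continuous_on {?d * real n..?d * real (Suc n)} (\<lambda>u. f (?d * (real n + 1)) - f u)"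
          by (intro continuous_intros continuous_on_subset[OF cont]) (use nn leB in auto)
        fix u assume u: "u \<in> {?d * real n..?d * real (Suc n)}"
        have "dist (?d * (real n + 1)) u \<le> ?d"
          using u by (auto simp: dist_real_def algebra_simps abs_if)
        moreover have "u \<in> {0..B}" using u nn leB by auto
        moreover have "?d * (real n + 1) \<in> {0..B}" using leB \<delta>x by (simp add: add.commute)
        ultimately have "dist (f (?d * (real n + 1))) (f u) < e'" using dx by (intro uc) auto
        then show "norm (f (?d * (real n + 1)) - f u) \<le> e'" by (simp add: dist_real_def)
      qed (rule le)
      also have "integral {?d * real n..?d * real (Suc n)} (\<lambda>u. f (?d * (real n + 1)) - f u) =
          ?d * f (?d * (real n + 1)) - ?I"
      proof -
        have "integral {?d * real n..?d * real (Suc n)} (\<lambda>u. f (?d * (real n + 1)) - f u) =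
            integral {?d * real n..?d * real (Suc n)} (\<lambda>u. f (?d * (real n + 1))) - ?I"
          by (intro Henstock_Kurzweil_Integration.integral_diff int) (use nn leB in auto)
        also have "integral {?d * real n..?d * real (Suc n)} (\<lambda>u. f (?d * (real n + 1))) = ?d * f (?d * (real n + 1))"
          using le by (simp add: algebra_simps)
        finally show ?thesis .
      qed
      finally have step: "\<bar>?d * f (?d * (real n + 1)) - ?I\<bar> \<le> ?d * e'" by (simp add: algebra_simps)
      have IH: "\<bar>?d * (\<Sum>j<n. f (?d * (real j + 1))) - integral {0..?d * real n} f\<bar> \<le> real n * (?d * e')"
        using Suc by simp
      have "?d * (\<Sum>j<Suc n. f (?d * (real j + 1))) = ?d * (\<Sum>j<n. f (?d * (real j + 1))) + ?d * f (?d * (real n + 1))"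
        by (simp add: distrib_left)
      moreover have "real (Suc n) * (?d * e') = real n * (?d * e') + ?d * e'" by (simp add: algebra_simps)
      ultimately show ?case using step IH comb by linarith
    qed simp
    have "integral {0..1} f + integral {1..?d * real (N x)} f = integral {0..?d * real (N x)} f"
      using Nx by (intro Henstock_Kurzweil_Integration.integral_combine int) auto
    moreover have "integral {1..?d * real (N x)} f = integral {1..?d * real (N x)} (\<lambda>_. 0)"
      by (rule integral_cong) (use zero in auto)
    ultimately have "integral {0..?d * real (N x)} f = integral {0..1} f" by simp
    then have "\<bar>?d * (\<Sum>j<N x. f (?d * (real j + 1))) - integral {0..1} f\<bar> \<le> (?d * real (N x)) * e'"
      using *[of "N x"] by (simp add: mult_ac)
    also have "\<dots> \<le> (\<bar>B\<bar> + 1) * e'" using Nx e' by (intro mult_right_mono) auto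
    also have "\<dots> = e / 2"
    proof -
      have "\<bar>B\<bar> + 1 > 0" by linarith
      then show ?thesis by (simp add: e'_def field_simps)
    qed
    also have "\<dots> < e" using e by simp
    finally show "dist (?d * (\<Sum>j<N x. f (?d * (real j + 1)))) (integral {0..1} f) < e" by (simp add: dist_real_def)
  qed
qed

lemma gamma_rate_nonneg:
  assumes "s > 0" "T > 0"
  shows "gamma_rate T s \<ge> 0"
proof -
  have "ln (T / s) \<le> T / s - 1" using assms by (intro ln_le_minus_one) auto
  then have "s * ln (T / s) \<le> T - s"
    using mult_left_mono[of "ln (T / s)" "T / s - 1" s] assms by (simp add: right_diff_distrib)
  then show ?thesis using assms by (simp add: gamma_rate_def ln_div right_diff_distrib)
qed

lemma gamma_rate_self [simp]: "gamma_rate s s = 0"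
  by (cases "s = 0") (simp_all add: gamma_rate_def)

lemma gamma_rate_scale:
  assumes "R > 0" "T > 0"
  shows "gamma_rate (T * R) (u * R) = R * gamma_rate T u"
  using assms by (simp add: gamma_rate_def algebra_simps)

text \<open>The rate of the larger of the two tails, below \<open>q R\<close> and above \<open>R\<close>, at shape \<open>u R\<close>. Clamping \<open>u\<close> to
  \<open>[q, 1]\<close> extends it by \<open>0\<close>, because one of the two rates vanishes at each end point.\<close>

definition gap_rate :: "real \<Rightarrow> real \<Rightarrow> real" where
  "gap_rate q u = (let v = max q (min 1 u) in min (gamma_rate 1 v) (gamma_rate q v))"

lemma continuous_on_gap_rate:
  assumes "0 < q"
  shows "continuous_on S (gap_rate q)"
  unfolding gap_rate_def Let_def gamma_rate_def
  by (intro continuous_intros) (use assms in auto)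

lemma gap_rate_inside: "q \<le> u \<Longrightarrow> u \<le> 1 \<Longrightarrow> gap_rate q u = min (gamma_rate 1 u) (gamma_rate q u)"
  by (simp add: gap_rate_def Let_def)

lemma gap_rate_above:
  assumes "0 < q" "q < 1" "1 \<le> u"
  shows "gap_rate q u = 0"
  using assms gamma_rate_nonneg[of 1 q] by (simp add: gap_rate_def Let_def)

lemma gap_rate_below:
  assumes "0 < q" "q < 1" "u \<le> q"
  shows "gap_rate q u = 0"
  using assms gamma_rate_nonneg[of q 1] by (simp add: gap_rate_def Let_def max_def)

lemma integral_gap_rate:
  assumes q: "0 < q" "q < 1"
  shows "integral {0..1} (gap_rate q) = 1 / 4 - q\<^sup>2 / 4 + (1 - q)\<^sup>2 / (2 * ln q)"
proof -
  define L where "L = ln q"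
  have L: "L < 0" using q by (simp add: L_def)
  \<comment> \<open>The point where the two rates cross.\<close>
  define p where "p = (1 - q) / (- L)"
  have "ln q \<le> q - 1" using q by (intro ln_le_minus_one) auto
  then have "1 - q \<le> 1 * (- L)" by (simp add: L_def)
  then have p1: "p \<le> 1" unfolding p_def by (subst pos_divide_le_eq) (use L in auto)
  have "ln (1 / q) \<le> 1 / q - 1" using q by (intro ln_le_minus_one) auto
  then have "- L * q \<le> 1 - q" using q by (simp add: L_def ln_div field_simps)
  then have pq: "q \<le> p" using L by (simp add: p_def field_simps)
  \<comment> \<open>An antiderivative of the rate with respect to the shape.\<close>
  define G where "G T u = T * u - u\<^sup>2 / 2 + (u\<^sup>2 / 2 * ln (u / T) - u\<^sup>2 / 4)" for T u :: real
  have G: "(G T has_vector_derivative gamma_rate T u) (at u within S)" if "T > 0" "u > 0" for T u S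
  proof -
    have "(G T has_real_derivative gamma_rate T u) (at u within S)"
      unfolding G_def gamma_rate_def
      by (rule derivative_eq_intros refl | use that in \<open>simp; fail\<close>)+
         (use that in \<open>simp add: field_simps power2_eq_square\<close>)
    then show ?thesis by (simp add: has_real_derivative_iff_has_vector_derivative)
  qed
  have i0: "(gap_rate q has_integral 0) {0..q}"
    by (rule has_integral_eq[of _ "\<lambda>_. 0"]) (use gap_rate_below[OF q] in auto)
  have i1: "(gap_rate q has_integral (G q p - G q q)) {q..p}"
  proof (rule has_integral_eq)
    show "(gamma_rate q has_integral (G q p - G q q)) {q..p}"
      by (rule fundamental_theorem_of_calculus[OF pq]) (use q in \<open>auto intro!: G\<close>)
    fix u assume u: "u \<in> {q..p}"
    have "u * (- L) \<le> 1 - q" using u L by (simp add: p_def field_simps)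
    moreover have "gamma_rate 1 u - gamma_rate q u = 1 - q - u * (- L)"
      using u q by (simp add: gamma_rate_def ln_div L_def algebra_simps)
    ultimately have "gamma_rate q u \<le> gamma_rate 1 u" by linarith
    then show "gamma_rate q u = gap_rate q u" using u p1 by (simp add: gap_rate_inside)
  qed
  have i2: "(gap_rate q has_integral (G 1 1 - G 1 p)) {p..1}"
  proof (rule has_integral_eq)
    show "(gamma_rate 1 has_integral (G 1 1 - G 1 p)) {p..1}"
      by (rule fundamental_theorem_of_calculus[OF p1]) (use q pq in \<open>auto intro!: G\<close>)
    fix u assume u: "u \<in> {p..1}"
    have "1 - q \<le> u * (- L)" using u L by (simp add: p_def field_simps)
    moreover have "gamma_rate 1 u - gamma_rate q u = 1 - q - u * (- L)"
      using u q pq by (simp add: gamma_rate_def ln_div L_def algebra_simps)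
    ultimately have "gamma_rate 1 u \<le> gamma_rate q u" by linarith
    then show "gamma_rate 1 u = gap_rate q u" using u pq by (simp add: gap_rate_inside)
  qed
  have "(gap_rate q has_integral (0 + (G q p - G q q))) {0..p}"
    by (rule has_integral_combine[OF _ pq i0 i1]) (use q in auto)
  then have "(gap_rate q has_integral (0 + (G q p - G q q) + (G 1 1 - G 1 p))) {0..1}"
    by (rule has_integral_combine[OF _ p1 _ i2, rotated]) (use q pq in auto)
  then have "integral {0..1} (gap_rate q) = 0 + (G q p - G q q) + (G 1 1 - G 1 p)" by (rule integral_unique)
  also have "\<dots> = G 1 1 - G q q - (G 1 p - G q p)" by simp
  also have "G 1 1 = 1 / 4" by (simp add: G_def)
  also have "G q q = q\<^sup>2 / 4" using q by (simp add: G_def power2_eq_square)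
  also have "G 1 p - G q p = (1 - q) * p + p\<^sup>2 / 2 * L"
    using q pq by (simp add: G_def L_def ln_div field_simps)
  also have "\<dots> = - ((1 - q)\<^sup>2 / (2 * L))"
    using L by (simp add: p_def field_simps power2_eq_square)
  finally show ?thesis by (simp add: L_def)
qed

text \<open>The probability that a gamma variable of shape \<open>s\<close> avoids the interval between \<open>q R\<close> and \<open>R\<close>.\<close>

definition gap_prob :: "real \<Rightarrow> real \<Rightarrow> real \<Rightarrow> real" where
  "gap_prob q s R = 1 - measure (gamma_law s) {q * R<..<R}"

lemma gap_prob_eq:
  assumes "s > 0" "R > 0" "q < 1"
  shows "gap_prob q s R = measure (gamma_law s) {..q * R} + measure (gamma_law s) {R..}"
proof -
  interpret prob_space "gamma_law s" by (rule prob_space_gamma_law) fact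
  have "q * R < R" using assms by simp
  then have "{..q * R} \<union> {R..} = space (gamma_law s) - {q * R<..<R}" "{..q * R} \<inter> {R..} = {}" by auto
  then have "prob (space (gamma_law s) - {q * R<..<R}) = prob {..q * R} + prob {R..}"
    using finite_measure_Union[of "{..q * R}" "{R..}"] by simp
  moreover have "prob (space (gamma_law s) - {q * R<..<R}) = 1 - prob {q * R<..<R}"
    by (rule prob_compl) simp
  ultimately show ?thesis by (simp add: gap_prob_def)
qed

lemma gap_prob_le_1: "gap_prob q s R \<le> 1"
  by (simp add: gap_prob_def)

lemma gap_rate_scale:
  assumes "0 < q" "R > 0" "q * R \<le> s" "s \<le> R"
  shows "R * gap_rate q (s / R) = min (gamma_rate R s) (gamma_rate (q * R) s)"
proof -
  have "gap_rate q (s / R) = min (gamma_rate 1 (s / R)) (gamma_rate q (s / R))"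
    by (rule gap_rate_inside) (use assms in \<open>auto simp: field_simps\<close>)
  moreover have "R * gamma_rate 1 (s / R) = gamma_rate R s" "R * gamma_rate q (s / R) = gamma_rate (q * R) s"
    using gamma_rate_scale[of R 1 "s / R"] gamma_rate_scale[of R q "s / R"] assms by simp_all
  ultimately show ?thesis using assms by (simp add: min_mult_distrib_left)
qed

lemma gap_prob_upper:
  assumes q: "0 < q" "q < 1" and "s > 0" "R > 0"
  shows "gap_prob q s R \<le> 2 * exp (- (R * gap_rate q (s / R)))"
proof (cases "q * R \<le> s \<and> s \<le> R")
  case True
  have "measure (gamma_law s) {..q * R} \<le> exp (- gamma_rate (q * R) s)"
    by (rule gamma_law_atMost_le) (use True assms in auto)
  moreover have "measure (gamma_law s) {R..} \<le> exp (- gamma_rate R s)"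
    by (rule gamma_law_atLeast_le) (use True assms in auto)
  moreover have "exp (- gamma_rate (q * R) s) \<le> exp (- (R * gap_rate q (s / R)))"
    "exp (- gamma_rate R s) \<le> exp (- (R * gap_rate q (s / R)))"
    using True assms by (simp_all add: gap_rate_scale)
  ultimately show ?thesis unfolding gap_prob_eq[OF assms(3,4) q(2)] by linarith
next
  case False
  then have "s / R \<le> q \<or> 1 \<le> s / R" using assms by (auto simp: field_simps)
  then have "gap_rate q (s / R) = 0" using gap_rate_below[OF q] gap_rate_above[OF q] by blast
  then show ?thesis using gap_prob_le_1[of q s R] by simp
qed

text \<open>For \<open>s\<close> outside \<open>[q R, R]\<close> the tail that contains the mean \<open>s\<close> is bounded below by the part of it
  beyond \<open>s\<close>, where the rate is \<open>0\<close>.\<close>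

lemma gap_prob_lower:
  assumes q: "0 < q" "q < 1" and s: "s > 0" and R: "q * R \<ge> 1"
  shows "q * exp (- (R * gap_rate q (s / R))) / (exp 1 * (s + 1)) \<le> gap_prob q s R"
proof -
  interpret prob_space "gamma_law s" by (rule prob_space_gamma_law) fact
  have "0 < q * R" using R by linarith
  then have R0: "R > 0" using q by (simp add: zero_less_mult_iff)
  have "q * R \<le> R" using q R0 by simp
  then have R1: "R \<ge> 1" using R by linarith
  note eq = gap_prob_eq[OF s R0 q(2)]
  have D: "exp 1 * (s + 1) > 0" using s by simp
  consider "s < q * R" | "q * R \<le> s" "s \<le> R" | "s > R" by linarith
  then show ?thesis
  proof cases
    case 1
    then have "s / R \<le> q" using R0 by (simp add: field_simps)
    then have "gap_rate q (s / R) = 0" by (rule gap_rate_below[OF q])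
    then have "q * exp (- (R * gap_rate q (s / R))) / (exp 1 * (s + 1)) \<le> exp (- gamma_rate s s) / (exp 1 * (s + 1))"
      using q D by (simp add: divide_right_mono)
    also have "\<dots> \<le> prob {..s}" by (rule gamma_law_atMost_ge) (use s in auto)
    also have "\<dots> \<le> prob {..q * R}" by (rule finite_measure_mono) (use 1 in auto)
    also have "\<dots> \<le> gap_prob q s R" unfolding eq by simp
    finally show ?thesis .
  next
    case 2
    have s1: "s \<ge> 1" using 2 R by linarith
    have a: "exp (- gamma_rate (q * R) s) / (exp 1 * (s + 1)) \<le> prob {..q * R}"
      by (rule gamma_law_atMost_ge) fact+
    have b: "s / R * (exp (- gamma_rate R s) / (exp 1 * (s + 1))) \<le> prob {R..}"
      by (rule gamma_law_atLeast_ge) fact+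
    have qs: "q \<le> s / R" using 2 R0 by (simp add: field_simps)
    have b': "q * (exp (- gamma_rate R s) / (exp 1 * (s + 1))) \<le> prob {R..}"
      using mult_right_mono[OF qs, of "exp (- gamma_rate R s) / (exp 1 * (s + 1))"] b D by (simp add: order_trans)
    have a': "q * (exp (- gamma_rate (q * R) s) / (exp 1 * (s + 1))) \<le> prob {..q * R}"
      using mult_right_mono[of q 1 "exp (- gamma_rate (q * R) s) / (exp 1 * (s + 1))"] a q D by (simp add: order_trans)
    have "R * gap_rate q (s / R) = gamma_rate R s \<or> R * gap_rate q (s / R) = gamma_rate (q * R) s"
      using gap_rate_scale[OF q(1) R0 2] by (simp add: min_def)
    then show ?thesis
    proof
      assume "R * gap_rate q (s / R) = gamma_rate R s"
      then have "q * exp (- (R * gap_rate q (s / R))) / (exp 1 * (s + 1)) \<le> prob {R..}" using b' by simp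
      also have "\<dots> \<le> gap_prob q s R" unfolding eq by simp
      finally show ?thesis .
    next
      assume "R * gap_rate q (s / R) = gamma_rate (q * R) s"
      then have "q * exp (- (R * gap_rate q (s / R))) / (exp 1 * (s + 1)) \<le> prob {..q * R}" using a' by simp
      also have "\<dots> \<le> gap_prob q s R" unfolding eq by simp
      finally show ?thesis .
    qed
  next
    case 3
    then have "1 \<le> s / R" using R0 by (simp add: field_simps)
    then have "gap_rate q (s / R) = 0" by (rule gap_rate_above[OF q])
    then have "q * exp (- (R * gap_rate q (s / R))) / (exp 1 * (s + 1)) \<le> s / s * (exp (- gamma_rate s s) / (exp 1 * (s + 1)))"
      using q s D by (simp add: divide_right_mono)
    also have "\<dots> \<le> prob {s..}" by (rule gamma_law_atLeast_ge) (use 3 R1 in auto)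
    also have "\<dots> \<le> prob {R..}" by (rule finite_measure_mono) (use 3 in auto)
    also have "\<dots> \<le> gap_prob q s R" unfolding eq by simp
    finally show ?thesis .
  qed
qed

text \<open>The constant \<open>9\<close> exceeds \<open>exp 2\<close>, so that the rate at \<open>s \<ge> 9 R\<close> is at least \<open>s\<close>.\<close>

lemma gap_prob_tail:
  assumes "R > 0" "9 * R \<le> s" "1 \<le> s"
  shows "exp (- (2 * exp (- s))) \<le> gap_prob q s R"
proof -
  have s: "s > 0" using assms by simp
  interpret prob_space "gamma_law s" by (rule prob_space_gamma_law) fact
  have "exp (2 :: real) = exp 1 * exp 1" by (simp flip: exp_add)
  also have "\<dots> \<le> 3 * 3" using exp_le by (intro mult_mono) auto
  finally have "exp (2 :: real) \<le> 9" by simp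
  also have "9 \<le> s / R" using assms by (simp add: field_simps)
  finally have "2 \<le> ln (s / R)" using s assms by (simp add: ln_ge_iff)
  then have "s * 2 \<le> s * ln (s / R)" using s by (intro mult_left_mono) auto
  then have rate: "s \<le> gamma_rate R s" using assms(1) unfolding gamma_rate_def by linarith
  have "prob {q * R<..<R} \<le> prob {..R}" by (rule finite_measure_mono) auto
  also have "\<dots> \<le> exp (- gamma_rate R s)" by (rule gamma_law_atMost_le) (use assms in auto)
  also have "\<dots> \<le> exp (- s)" using rate by simp
  finally have le: "1 - exp (- s) \<le> gap_prob q s R" by (simp add: gap_prob_def)
  let ?x = "exp (- s)"
  have x: "0 \<le> ?x" "?x \<le> 1 / 2"
  proof -
    have "2 \<le> exp (1 :: real)" using exp_ge_add_one_self[of 1] by simp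
    also have "\<dots> \<le> exp s" using assms by simp
    finally show "?x \<le> 1 / 2" by (simp add: exp_minus field_simps)
  qed simp
  have "- ?x - 2 * ?x\<^sup>2 \<le> ln (1 - ?x)" by (rule ln_one_minus_pos_lower_bound) (use x in auto)
  moreover have "2 * ?x\<^sup>2 \<le> ?x" using mult_left_mono[OF x(2) x(1)] by (simp add: power2_eq_square)
  ultimately have "- (2 * ?x) \<le> ln (1 - ?x)" by linarith
  moreover have "0 < 1 - ?x" using x by linarith
  ultimately have "exp (- (2 * ?x)) \<le> 1 - ?x" by (simp only: ln_ge_iff)
  then show ?thesis using le by linarith
qed

section \<open>Asymptotics of the hole probability\<close>

text \<open>The logarithm of the product is \<open>- R S(R)\<close> up to an error \<open>O(R ln R)\<close>, where \<open>S(R)\<close> sums the rates. The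
  first \<open>N(R)\<close> factors, which include all with \<open>s\<^sub>j < 9 R\<close>, are treated by the two-sided bounds, the other
  factors by \<open>gap_prob_tail\<close>.\<close>

lemma ln_gap_product_asymptotics:
  fixes \<alpha> q :: real and V :: "real \<Rightarrow> real"
  assumes \<alpha>: "\<alpha> > 0" and q: "0 < q" "q < 1"
    and V: "\<And>R. R > 0 \<Longrightarrow> (\<lambda>n. \<Prod>j<n. gap_prob q (ml_shape \<alpha> j) R) \<longlonglongrightarrow> V R"
  shows "((\<lambda>R. ln (V R) / R\<^sup>2) \<longlongrightarrow> - (\<alpha> / 2) * (1 / 4 - q\<^sup>2 / 4 + (1 - q)\<^sup>2 / (2 * ln q))) at_top"
proof -
  let ?s = "ml_shape \<alpha>"
  note s = ml_shape_pos[OF \<alpha>]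
  \<comment> \<open>The second summand ensures that the remaining shapes are at least 1.\<close>
  define N where "N R = nat \<lceil>9 * R * \<alpha> / 2\<rceil> + nat \<lceil>\<alpha> / 2\<rceil>" for R
  define S where "S R = (\<Sum>j<N R. gap_rate q (?s j / R))" for R
  define C where "C = (\<Sum>j. 2 * exp (- ?s j))"
  \<comment> \<open>An upper bound for the number of factors treated by the two-sided bounds.\<close>
  define T where "T R = 9 * R * \<alpha> / 2 + \<alpha> / 2 + 2" for R
  define err where "err R = T R * (1 - ln q + ln (2 / \<alpha> * T R + 1)) + C" for R
  have summ: "summable (\<lambda>j. 2 * exp (- ?s j))"
  proof -
    have "exp (- ?s j) = exp (- (2 / \<alpha>)) * exp (- (2 / \<alpha>)) ^ j" for j
      by (simp add: ml_shape_def exp_of_nat_mult[symmetric] mult_ac flip: exp_add)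
    moreover have "norm (exp (- (2 / \<alpha>))) < 1" using \<alpha> by simp
    ultimately show ?thesis by (simp only: summable_mult summable_geometric)
  qed
  have N_ge: "9 * R \<le> ?s j" "1 \<le> ?s j" if "R > 0" "j \<ge> N R" for R j
  proof -
    have "9 * R * \<alpha> / 2 \<le> real (nat \<lceil>9 * R * \<alpha> / 2\<rceil>)" "\<alpha> / 2 \<le> real (nat \<lceil>\<alpha> / 2\<rceil>)"
      by (rule real_nat_ceiling_ge)+
    then have "9 * R * \<alpha> / 2 \<le> real (N R)" "\<alpha> / 2 \<le> real (N R)" by (simp_all add: N_def)
    then have *: "9 * R * \<alpha> / 2 \<le> real j" "\<alpha> / 2 \<le> real j" using that by linarith+
    have "?s j \<ge> 2 / \<alpha> * real j" using \<alpha> by (simp add: ml_shape_def)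
    moreover have "2 / \<alpha> * real j \<ge> 9 * R" "2 / \<alpha> * real j \<ge> 1" using * \<alpha> by (simp_all add: field_simps)
    ultimately show "9 * R \<le> ?s j" "1 \<le> ?s j" by linarith+
  qed
  have N_le: "real (N R) \<le> T R" if "R > 0" for R
  proof -
    have "0 \<le> 9 * R * \<alpha> / 2" "0 \<le> \<alpha> / 2" using that \<alpha> by simp_all
    then have "0 \<le> \<lceil>9 * R * \<alpha> / 2\<rceil>" "0 \<le> \<lceil>\<alpha> / 2\<rceil>" by linarith+
    then have "real (N R) = of_int \<lceil>9 * R * \<alpha> / 2\<rceil> + of_int \<lceil>\<alpha> / 2\<rceil>" by (simp add: N_def)
    then show ?thesis unfolding T_def by linarith
  qed
  have bound: "\<bar>ln (V R) + R * S R\<bar> \<le> err R" if R: "q * R \<ge> 1" for R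
  proof -
    have "0 < q * R" using R by linarith
    then have R0: "R > 0" using q by (simp add: zero_less_mult_iff)
    let ?h = "\<lambda>j. gap_prob q (?s j) R"
    let ?\<phi> = "\<lambda>j. gap_rate q (?s j / R)"
    have hpos: "?h j > 0" for j
    proof -
      have "0 < q * exp (- (R * ?\<phi> j)) / (exp 1 * (?s j + 1))"
        using q s[of j] by (auto intro!: divide_pos_pos mult_pos_pos)
      also have "\<dots> \<le> ?h j" by (rule gap_prob_lower[OF q s R])
      finally show ?thesis .
    qed
    have T0: "T R \<ge> 0" using R0 \<alpha> by (simp add: T_def)
    have lnq: "ln q \<le> 0" using q by simp
    let ?D = "1 - ln q + ln (2 / \<alpha> * T R + 1)"
    have "0 \<le> ln (2 / \<alpha> * T R + 1)" using T0 \<alpha> by (intro ln_ge_zero) simp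
    then have D1: "?D \<ge> 1" using lnq by linarith
    have lower: "- (R * ?\<phi> j) - ?D \<le> ln (?h j)" if j: "j < N R" for j
    proof -
      have sj: "?s j \<le> 2 / \<alpha> * T R"
      proof -
        have "real j + 1 \<le> T R" using j N_le[OF R0] by linarith
        then have "2 / \<alpha> * (real j + 1) \<le> 2 / \<alpha> * T R" using \<alpha> by (intro mult_left_mono) auto
        moreover have "?s j = 2 / \<alpha> * (real j + 1)" by (simp add: ml_shape_def distrib_left)
        ultimately show ?thesis by simp
      qed
      have "ln (q * exp (- (R * ?\<phi> j)) / (exp 1 * (?s j + 1))) \<le> ln (?h j)"
        using gap_prob_lower[OF q s R, of j] hpos[of j] q s[of j] by (intro ln_mono) (auto intro!: divide_pos_pos mult_pos_pos)
      also have "ln (q * exp (- (R * ?\<phi> j)) / (exp 1 * (?s j + 1))) = ln q - R * ?\<phi> j - 1 - ln (?s j + 1)"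
        using q s[of j] by (simp add: ln_div ln_mult)
      finally have "ln q - R * ?\<phi> j - 1 - ln (?s j + 1) \<le> ln (?h j)" .
      moreover have "ln (?s j + 1) \<le> ln (2 / \<alpha> * T R + 1)" using sj s[of j] by (intro ln_mono) auto
      ultimately show ?thesis by linarith
    qed
    have upper: "ln (?h j) \<le> - (R * ?\<phi> j) + 1" for j
    proof -
      have "ln (?h j) \<le> ln (2 * exp (- (R * ?\<phi> j)))"
        using gap_prob_upper[OF q s R0, of j] hpos[of j] by (intro ln_mono) auto
      also have "\<dots> = ln 2 - R * ?\<phi> j" by (simp add: ln_mult)
      finally show ?thesis using ln_2_less_1 by linarith
    qed
    have sumS: "(\<Sum>j<N R. - (R * ?\<phi> j)) = - (R * S R)"
      by (simp add: S_def sum_negf sum_distrib_left)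
    have NT: "real (N R) * ?D \<le> T R * ?D" using N_le[OF R0] D1 by (intro mult_right_mono) auto
    have Cnn: "0 \<le> C" unfolding C_def by (intro suminf_nonneg summ) simp
    have lo: "exp (- (R * S R) - err R) \<le> (\<Prod>j<n. ?h j)" if n: "n \<ge> N R" for n
    proof -
      have split: "{..<n} = {..<N R} \<union> {N R..<n}" using n by auto
      have "- (R * S R) - err R \<le> (\<Sum>j<N R. - (R * ?\<phi> j) - ?D) - (\<Sum>j=N R..<n. 2 * exp (- ?s j))"
      proof -
        have "(\<Sum>j=N R..<n. 2 * exp (- ?s j)) \<le> C" unfolding C_def by (rule sum_le_suminf[OF summ]) auto
        moreover have "(\<Sum>j<N R. - (R * ?\<phi> j) - ?D) = - (R * S R) - real (N R) * ?D"
          using sumS by (simp only: sum_subtractf sum_constant card_lessThan)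
        ultimately show ?thesis using NT unfolding err_def by linarith
      qed
      also have "\<dots> \<le> (\<Sum>j<N R. ln (?h j)) + (\<Sum>j=N R..<n. ln (?h j))"
      proof -
        have "(\<Sum>j<N R. - (R * ?\<phi> j) - ?D) \<le> (\<Sum>j<N R. ln (?h j))" by (rule sum_mono) (use lower in auto)
        moreover have "(\<Sum>j=N R..<n. - (2 * exp (- ?s j))) \<le> (\<Sum>j=N R..<n. ln (?h j))"
        proof (rule sum_mono)
          fix j assume "j \<in> {N R..<n}"
          then have "exp (- (2 * exp (- ?s j))) \<le> ?h j" using N_ge[OF R0, of j] R0 by (intro gap_prob_tail) auto
          then show "- (2 * exp (- ?s j)) \<le> ln (?h j)" using hpos[of j] by (simp only: ln_ge_iff)
        qed
        ultimately show ?thesis by (simp add: sum_negf)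
      qed
      also have "\<dots> = (\<Sum>j<n. ln (?h j))" unfolding split by (rule sum.union_disjoint[symmetric]) auto
      also have "\<dots> = ln (\<Prod>j<n. ?h j)"
        by (rule ln_prod[symmetric]) (use hpos in \<open>auto simp: less_imp_neq[symmetric]\<close>)
      finally show ?thesis using hpos by (subst (asm) ln_ge_iff) (auto intro: prod_pos)
    qed
    have up: "(\<Prod>j<n. ?h j) \<le> exp (- (R * S R) + err R)" if n: "n \<ge> N R" for n
    proof -
      have split: "{..<n} = {..<N R} \<union> {N R..<n}" using n by auto
      have "(\<Prod>j<n. ?h j) = (\<Prod>j<N R. ?h j) * (\<Prod>j=N R..<n. ?h j)"
        unfolding split by (rule prod.union_disjoint) auto
      also have "\<dots> \<le> (\<Prod>j<N R. ?h j) * 1"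
        using hpos by (intro mult_left_mono prod_le_1 prod_nonneg) (auto intro: less_imp_le gap_prob_le_1)
      also have "(\<Prod>j<N R. ?h j) = exp (\<Sum>j<N R. ln (?h j))"
        using hpos by (simp add: exp_sum)
      also have "(\<Sum>j<N R. ln (?h j)) \<le> (\<Sum>j<N R. - (R * ?\<phi> j) + 1)" by (rule sum_mono) (rule upper)
      also have "\<dots> = - (R * S R) + real (N R)" using sumS by (simp only: sum.distrib sum_constant card_lessThan mult_1_right)
      also have "\<dots> \<le> - (R * S R) + err R"
        using NT mult_left_mono[OF D1, of "real (N R)"] Cnn unfolding err_def by linarith
      finally show ?thesis by simp
    qed
    have "exp (- (R * S R) - err R) \<le> V R"
      by (rule LIMSEQ_le_const[OF V[OF R0]]) (use lo in blast)
    moreover have "V R \<le> exp (- (R * S R) + err R)"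
      by (rule LIMSEQ_le_const2[OF V[OF R0]]) (use up in blast)
    moreover have "V R > 0" using calculation(1) exp_gt_zero less_le_trans by blast
    ultimately have "- (R * S R) - err R \<le> ln (V R)" "ln (V R) \<le> - (R * S R) + err R"
      by (simp_all add: ln_ge_iff ln_le_cancel_iff[symmetric, of "V R"] del: ln_le_cancel_iff)
    then show ?thesis by linarith
  qed
  have evq: "\<forall>\<^sub>F R in at_top. q * R \<ge> 1" and ev0: "\<forall>\<^sub>F R::real in at_top. R > 0"
  proof -
    show "\<forall>\<^sub>F R in at_top. q * R \<ge> 1"
      using eventually_ge_at_top[of "1 / q"] by eventually_elim (use q in \<open>simp add: field_simps\<close>)
  qed (rule eventually_gt_at_top)
  have riem: "((\<lambda>R. 2 / (\<alpha> * R) * (\<Sum>j<N R. gap_rate q (2 / (\<alpha> * R) * (real j + 1)))) \<longlongrightarrow> integral {0..1} (gap_rate q)) at_top"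
  proof (rule riemann_sum_tendsto[where B = "10"])
    show "continuous_on {0..10} (gap_rate q)" by (rule continuous_on_gap_rate[OF q(1)])
    show "gap_rate q u = 0" if "u \<ge> 1" for u using gap_rate_above[OF q that] .
    show "((\<lambda>R. 2 / (\<alpha> * R)) \<longlongrightarrow> 0) at_top" using \<alpha> by real_asymp
    show "\<forall>\<^sub>F R in at_top. 2 / (\<alpha> * R) > 0" using ev0 by eventually_elim (use \<alpha> in simp)
    have "\<forall>\<^sub>F R in at_top. 2 / (\<alpha> * R) * T R \<le> 10" unfolding T_def using \<alpha> by real_asymp
    with ev0 show "\<forall>\<^sub>F R in at_top. 1 \<le> 2 / (\<alpha> * R) * real (N R) \<and> 2 / (\<alpha> * R) * real (N R) \<le> 10"
    proof eventually_elim
      fix R :: real assume R: "R > 0" and le: "2 / (\<alpha> * R) * T R \<le> 10"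
      have p: "2 / (\<alpha> * R) > 0" using R \<alpha> by simp
      have "9 * R * \<alpha> / 2 \<le> real (nat \<lceil>9 * R * \<alpha> / 2\<rceil>)" by (rule real_nat_ceiling_ge)
      then have "9 * R * \<alpha> / 2 \<le> real (N R)" by (simp add: N_def)
      then have "2 / (\<alpha> * R) * (9 * R * \<alpha> / 2) \<le> 2 / (\<alpha> * R) * real (N R)" using p by (intro mult_left_mono) auto
      moreover have "2 / (\<alpha> * R) * (9 * R * \<alpha> / 2) = 9" using R \<alpha> by simp
      moreover have "2 / (\<alpha> * R) * real (N R) \<le> 2 / (\<alpha> * R) * T R" using p N_le[OF R] by (intro mult_left_mono) auto
      ultimately show "1 \<le> 2 / (\<alpha> * R) * real (N R) \<and> 2 / (\<alpha> * R) * real (N R) \<le> 10" using le by linarith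
    qed
  qed
  have Slim: "((\<lambda>R. S R / R) \<longlongrightarrow> \<alpha> / 2 * integral {0..1} (gap_rate q)) at_top"
  proof (rule Lim_transform_eventually[OF tendsto_mult_left[OF riem, of "\<alpha> / 2"]])
    show "\<forall>\<^sub>F R in at_top. \<alpha> / 2 * (2 / (\<alpha> * R) * (\<Sum>j<N R. gap_rate q (2 / (\<alpha> * R) * (real j + 1)))) = S R / R"
      using ev0
    proof eventually_elim
      fix R :: real assume R: "R > 0"
      have "2 / (\<alpha> * R) * (real j + 1) = ?s j / R" for j
        using R \<alpha> by (simp add: ml_shape_def field_simps)
      then show "\<alpha> / 2 * (2 / (\<alpha> * R) * (\<Sum>j<N R. gap_rate q (2 / (\<alpha> * R) * (real j + 1)))) = S R / R"
        using \<alpha> by (simp add: S_def)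
    qed
  qed
  have errlim: "((\<lambda>R. err R / R\<^sup>2) \<longlongrightarrow> 0) at_top"
    unfolding err_def T_def using \<alpha> by real_asymp
  have "((\<lambda>R. ln (V R) / R\<^sup>2 + S R / R) \<longlongrightarrow> 0) at_top"
  proof (rule Lim_null_comparison[OF _ errlim])
    show "\<forall>\<^sub>F R in at_top. norm (ln (V R) / R\<^sup>2 + S R / R) \<le> err R / R\<^sup>2"
      using evq ev0
    proof eventually_elim
      fix R assume R: "q * R \<ge> 1" "R > 0"
      have "ln (V R) / R\<^sup>2 + S R / R = (ln (V R) + R * S R) / R\<^sup>2"
        using R(2) by (simp add: add_divide_distrib power2_eq_square)
      then show "norm (ln (V R) / R\<^sup>2 + S R / R) \<le> err R / R\<^sup>2"
        using bound[OF R(1)] by (simp add: divide_right_mono)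
    qed
  qed
  from tendsto_diff[OF this Slim] show ?thesis by (simp add: integral_gap_rate[OF q])
qed

lemma scaled_annulus:
  assumes "r > 0"
  shows "(\<lambda>z. complex_of_real r * z) ` annulus c = shell (r * c) r"
proof (intro equalityI subsetI)
  fix z assume "z \<in> shell (r * c) r"
  then have "z / complex_of_real r \<in> annulus c"
    using assms by (simp add: shell_def annulus_def norm_divide field_simps)
  then show "z \<in> (\<lambda>z. complex_of_real r * z) ` annulus c"
    using assms by (intro image_eqI[of _ _ "z / complex_of_real r"]) auto
qed (use assms in \<open>auto simp: shell_def annulus_def norm_mult\<close>)

theorem theorem4p2:
  fixes M :: "'w measure" and X :: "'w \<Rightarrow> complex set" and \<alpha> c :: real
  assumes "\<alpha> > 0" and "0 < c" and "c < 1"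
    and "determinantal_process M X (mittag_leffler_kernel \<alpha>)"
  shows "((\<lambda>r::real. 1 / r powr (2 * \<alpha>) *
            ln (measure M {\<omega> \<in> space M. num_points X ((\<lambda>z. complex_of_real r * z) ` annulus c) \<omega> = 0}))
          \<longlongrightarrow> - (\<alpha> / 2) * (1 / 4 - c powr (2 * \<alpha>) / 4 + (1 - c powr \<alpha>)\<^sup>2 / (2 * \<alpha> * ln c))) at_top"
proof -
  define q where "q = c powr \<alpha>"
  have q: "0 < q" "q < 1"
    using assms powr_less_mono2[of \<alpha> c 1] by (simp_all add: q_def)
  define V where "V R = measure M {\<omega> \<in> space M. num_points X
      ((\<lambda>z. complex_of_real (R powr (1 / \<alpha>)) * z) ` annulus c) \<omega> = 0}" for R
  have V: "(\<lambda>n. \<Prod>j<n. gap_prob q (ml_shape \<alpha> j) R) \<longlonglongrightarrow> V R" if R: "R > 0" for R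
  proof -
    define r where "r = R powr (1 / \<alpha>)"
    have r: "r > 0" "r powr \<alpha> = R" using R assms by (simp_all add: r_def powr_powr)
    have rc: "(r * c) powr \<alpha> = q * R" using r assms by (simp add: powr_mult q_def mult.commute)
    have "(\<lambda>n. \<Prod>j<n. 1 - shell_prob \<alpha> (r * c) r j) \<longlonglongrightarrow>
        measure M {\<omega> \<in> space M. num_points X (shell (r * c) r) \<omega> = 0}"
      by (rule ml_void_probability) (use assms r in auto)
    then show ?thesis
      unfolding V_def r_def[symmetric] scaled_annulus[OF r(1)] gap_prob_def shell_prob_def rc r(2) .
  qed
  have "((\<lambda>r. ln (V (r powr \<alpha>)) / (r powr \<alpha>)\<^sup>2) \<longlongrightarrow>
      - (\<alpha> / 2) * (1 / 4 - q\<^sup>2 / 4 + (1 - q)\<^sup>2 / (2 * ln q))) at_top"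
  proof (rule filterlim_compose[OF ln_gap_product_asymptotics[OF assms(1) q V]])
    show "filterlim (\<lambda>r. r powr \<alpha>) at_top at_top" using assms(1) by real_asymp
  qed
  moreover have "q\<^sup>2 = c powr (2 * \<alpha>)"
    using assms by (simp add: q_def power2_eq_square flip: powr_add)
  moreover have "ln q = \<alpha> * ln c" using assms by (simp add: q_def ln_powr)
  ultimately have lim: "((\<lambda>r. ln (V (r powr \<alpha>)) / (r powr \<alpha>)\<^sup>2) \<longlongrightarrow>
      - (\<alpha> / 2) * (1 / 4 - c powr (2 * \<alpha>) / 4 + (1 - c powr \<alpha>)\<^sup>2 / (2 * \<alpha> * ln c))) at_top"
    by (simp add: q_def mult.assoc)
  show ?thesis
  proof (rule Lim_transform_eventually[OF lim])
    show "\<forall>\<^sub>F r in at_top. ln (V (r powr \<alpha>)) / (r powr \<alpha>)\<^sup>2 = 1 / r powr (2 * \<alpha>) *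
            ln (measure M {\<omega> \<in> space M. num_points X ((\<lambda>z. complex_of_real r * z) ` annulus c) \<omega> = 0})"
      using eventually_gt_at_top[of 0]
    proof eventually_elim
      fix r :: real assume r: "r > 0"
      have "(r powr \<alpha>) powr (1 / \<alpha>) = r" using r assms(1) by (simp add: powr_powr)
      moreover have "(r powr \<alpha>)\<^sup>2 = r powr (2 * \<alpha>)" by (simp add: power2_eq_square flip: powr_add)
      ultimately show "ln (V (r powr \<alpha>)) / (r powr \<alpha>)\<^sup>2 = 1 / r powr (2 * \<alpha>) *
            ln (measure M {\<omega> \<in> space M. num_points X ((\<lambda>z. complex_of_real r * z) ` annulus c) \<omega> = 0})"
        by (simp add: V_def)
    qed
  qed
qed

end
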